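(* For every even integer $k \geq 4$, every positive integer $u \equiv 1 \pmod k$ and every integer $g \geq 2$, there exists a $k$-ARCS of $(K_u \times K_g)(2)$.
   Context: For graphs $G,H$, the tensor product $G \times H$ has vertex set $V(G)\times V(H)$, with $(g_1,h_1)$ adjacent to $(g_2,h_2)$ iff $g_1g_2 \in E(G)$ and $h_1h_2 \in E(H)$. For a graph $G$ and positive integer $\lambda$, $G(\lambda)$ is the multigraph obtained by replacing each edge of $G$ by $\lambda$ parallel edges. $K_n$ is the complete graph on $n$ vertices. $(K_u \times K_g)(\lambda)$ is regarded as a $u$-partite multigraph with partite sets $V_i = \{i\}\times V(K_g)$, $i=1,\dots,u$. A partial $C_k$-factor of $(K_u \times K_g)(\lambda)$ is a subgraph which, for some $i$, is a spanning subgraph of $(K_u \times K_g)(\lambda)\setminus V_i$ all of whose components are cycles of length $k$. A $k$-ARCS of $(K_u \times K_g)(\lambda)$ is a partition of its edge multiset into partial $C_k$-factors. *)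

theory Defs
  imports "HOL-Library.Multiset" "HOL-Number_Theory.Cong"
begin

text \<open>Edges are sets of end vertices; a multigraph has a multiset of them.\<close>

record 'a sgraph =
  sverts :: "'a set"
  sedges :: "'a set set"

record 'a mgraph =
  mverts :: "'a set"
  medges :: "'a set multiset"

definition complete_sgraph :: "nat \<Rightarrow> nat sgraph" where
  "complete_sgraph n = \<lparr>sverts = {1..n}, sedges = {e. e \<subseteq> {1..n} \<and> card e = 2}\<rparr>"

definition tensor_product :: "'a sgraph \<Rightarrow> 'b sgraph \<Rightarrow> ('a \<times> 'b) sgraph" where
  "tensor_product G H =
     \<lparr>sverts = sverts G \<times> sverts H,
      sedges = {{(g1, h1), (g2, h2)} | g1 h1 g2 h2.
                  {g1, g2} \<in> sedges G \<and> {h1, h2} \<in> sedges H}\<rparr>"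

definition edge_multiple :: "'a sgraph \<Rightarrow> nat \<Rightarrow> 'a mgraph" where
  "edge_multiple G l =
     \<lparr>mverts = sverts G, medges = repeat_mset l (mset_set (sedges G))\<rparr>"

definition induced_mgraph :: "'a mgraph \<Rightarrow> 'a set \<Rightarrow> 'a mgraph" where
  "induced_mgraph G W =
     \<lparr>mverts = mverts G \<inter> W, medges = filter_mset (\<lambda>e. e \<subseteq> W) (medges G)\<rparr>"

definition delete_verts :: "'a mgraph \<Rightarrow> 'a set \<Rightarrow> 'a mgraph" where
  "delete_verts G W = induced_mgraph G (mverts G - W)"

definition mg_subgraph :: "'a mgraph \<Rightarrow> 'a mgraph \<Rightarrow> bool" where
  "mg_subgraph H G \<longleftrightarrow>
     mverts H \<subseteq> mverts G \<and> medges H \<subseteq># medges G \<and> (\<forall>e \<in># medges H. e \<subseteq> mverts H)"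

definition spanning_mg_subgraph :: "'a mgraph \<Rightarrow> 'a mgraph \<Rightarrow> bool" where
  "spanning_mg_subgraph H G \<longleftrightarrow> mg_subgraph H G \<and> mverts H = mverts G"

definition mg_adj :: "'a mgraph \<Rightarrow> 'a \<Rightarrow> 'a \<Rightarrow> bool" where
  "mg_adj G x y \<longleftrightarrow> {x, y} \<in># medges G"

definition mg_components :: "'a mgraph \<Rightarrow> 'a mgraph set" where
  "mg_components G = {induced_mgraph G {w. (mg_adj G)\<^sup>*\<^sup>* v w} | v. v \<in> mverts G}"

definition is_cycle_of_length :: "nat \<Rightarrow> 'a mgraph \<Rightarrow> bool" where
  "is_cycle_of_length k G \<longleftrightarrow>
     (\<exists>xs. distinct xs \<and> length xs = k \<and> mverts G = set xs \<and>
        medges G = image_mset (\<lambda>i. {xs ! i, xs ! (Suc i mod k)}) (mset_set {..<k}))"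

definition KxK :: "nat \<Rightarrow> nat \<Rightarrow> nat \<Rightarrow> (nat \<times> nat) mgraph" where
  "KxK u g l = edge_multiple (tensor_product (complete_sgraph u) (complete_sgraph g)) l"

definition partite_set :: "nat \<Rightarrow> nat \<Rightarrow> (nat \<times> nat) set" where
  "partite_set g i = {i} \<times> sverts (complete_sgraph g)"

definition partial_cycle_factor ::
    "nat \<Rightarrow> nat \<Rightarrow> nat \<Rightarrow> nat \<Rightarrow> (nat \<times> nat) mgraph \<Rightarrow> bool" where
  "partial_cycle_factor k u g l P \<longleftrightarrow>
     (\<exists>i \<in> {1..u}. spanning_mg_subgraph P (delete_verts (KxK u g l) (partite_set g i)) \<and>
        (\<forall>C \<in> mg_components P. is_cycle_of_length k C))"

text \<open>The family is a multiset, since the same partial factor may occur several times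
  when edges are parallel.\<close>

definition is_ARCS ::
    "nat \<Rightarrow> nat \<Rightarrow> nat \<Rightarrow> nat \<Rightarrow> (nat \<times> nat) mgraph multiset \<Rightarrow> bool" where
  "is_ARCS k u g l F \<longleftrightarrow>
     (\<forall>P \<in># F. partial_cycle_factor k u g l P) \<and>
     \<Sum>\<^sub># (image_mset medges F) = medges (KxK u g l)"

end

theory Submission
  imports Defs
begin

text \<open>Write \<open>k = 2 m\<close> and \<open>u = k t + 1\<close>. The complete digraph on \<open>u\<close> vertices has a decomposition into
  \<open>u\<close> near-factors, one missing each vertex, whose components are directed \<open>k\<close>-cycles. Forgetting
  orientations, this covers every edge twice. As \<open>k\<close> is even, the vertices of each cycle can be
  coloured alternately; moving the second coordinate by \<open>+s\<close> and \<open>-s\<close> in turn along a cycle lifts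
  every near-factor to \<open>g - 1\<close> partial factors of the tensor product with \<open>K\<^sub>g\<close>, one for each nonzero
  \<open>s\<close> in \<open>\<int>\<^sub>g\<close>, and every ordered pair of adjacent vertices is used exactly once.

  For \<open>t = 1\<close> and \<open>t = 2\<close> the near-factors are found by explicit difference constructions in
  \<open>\<int>\<^bsub>2 m\<^esub> \<union> {\<infinity>}\<close> and \<open>\<int>\<^bsub>4 m + 1\<^esub>\<close>. For \<open>t = s t'\<close> with \<open>s\<close> odd or \<open>s = 4\<close>, split the vertices other
  than \<open>\<infinity>\<close> into \<open>s\<close> groups of \<open>k t'\<close> points and each group into two halves. A one-factorization with
  holes on the \<open>2 s\<close> halves gives the factors on the arcs between different groups, and a solution
  for \<open>t'\<close> fills each group together with \<open>\<infinity>\<close>. Every \<open>t\<close> arises in this way from 1 and 2.\<close>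

section \<open>Near-factors with directed cycles\<close>

definition k_orbit :: "nat \<Rightarrow> ('a \<Rightarrow> 'a) \<Rightarrow> 'a \<Rightarrow> bool" where
  "k_orbit k f x \<longleftrightarrow> (f ^^ k) x = x \<and> (\<forall>i. 0 < i \<and> i < k \<longrightarrow> (f ^^ i) x \<noteq> x)"

text \<open>Iterates of \<open>f\<close> stay in \<open>X\<close> and correspond under
  \<open>h\<close> to iterates of \<open>g\<close>; injectivity keeps them apart. This carries
  cycles to relabelled and embedded copies.\<close>

lemma k_orbit_transfer:
  assumes "k_orbit k f x" and "x \<in> X" and "inj_on h X"
    and closed: "\<And>y. y \<in> X \<Longrightarrow> f y \<in> X" and comm: "\<And>y. y \<in> X \<Longrightarrow> g (h y) = h (f y)"
  shows "k_orbit k g (h x)"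
proof -
  have "(f ^^ i) x \<in> X \<and> (g ^^ i) (h x) = h ((f ^^ i) x)" for i
    by (induction i) (auto simp: closed comm \<open>x \<in> X\<close>)
  then show ?thesis
    using assms(1,2,3) unfolding k_orbit_def by (metis inj_onD)
qed

lemma k_orbit_enumI:
  assumes step: "\<And>i. i < k \<Longrightarrow> f (e i) = e (Suc i mod k)" and "inj_on e {..<k}" and "i < k"
  shows "k_orbit k f (e i)"
proof -
  have iter: "(f ^^ j) (e i) = e ((i + j) mod k)" for j
  proof (induction j)
    case (Suc j)
    have "(i + j) mod k < k" using \<open>i < k\<close> by simp
    then show ?case using Suc step[of "(i + j) mod k"] by (simp add: mod_Suc_eq)
  qed (use \<open>i < k\<close> in simp)
  moreover have "e ((i + j) mod k) \<noteq> e i" if "0 < j" "j < k" for j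
  proof
    assume "e ((i + j) mod k) = e i"
    then have "(i + j) mod k = i"
      using \<open>inj_on e {..<k}\<close> \<open>i < k\<close> by (auto dest!: inj_onD)
    then show False
      using that \<open>i < k\<close> by (cases "i + j < k") (auto simp: le_mod_geq not_less)
  qed
  ultimately show ?thesis
    using \<open>i < k\<close> unfolding k_orbit_def by simp
qed

text \<open>On both points, \<open>k - 1\<close> further steps undo \<open>f\<close>.\<close>

lemma k_orbit_eqD:
  assumes "k_orbit k f x" and "k_orbit k f y" and "f x = f y" and "k > 0"
  shows "x = y"
proof -
  have "(f ^^ k) z = (f ^^ (k - 1)) (f z)" for z
    using \<open>k > 0\<close> by (metis Suc_diff_1 comp_apply funpow_Suc_right)
  then show ?thesis using assms by (metis k_orbit_def)
qed

text \<open>The colour is the parity of the number of steps to a representative of the orbit. A step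
  along \<open>f\<close> lowers this number by 1, except at the representative, where it jumps from
  0 to the odd number \<open>k - 1\<close>.\<close>

lemma k_orbit_even_colouring:
  assumes "even k" and "k > 0" and orb: "\<And>x. x \<in> X \<Longrightarrow> k_orbit k f x"
  shows "\<exists>c :: 'a \<Rightarrow> bool. \<forall>x\<in>X. c (f x) \<longleftrightarrow> \<not> c x"
proof -
  have shift: "(f ^^ Suc j) x = (f ^^ j) (f x)" for j x
    by (simp only: funpow_Suc_right comp_apply)
  define orbit where "orbit x = {(f ^^ i) x | i. True}" for x
  define rep where "rep x = (SOME y. y \<in> orbit x)" for x
  define d where "d x = (LEAST i. (f ^^ i) x = rep x)" for x
  have fk: "(f ^^ (k - 1)) (f x) = x" if "x \<in> X" for x
    using orb[OF that] \<open>k > 0\<close> unfolding k_orbit_def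
    by (metis Suc_diff_1 comp_apply funpow_Suc_right)
  have orbit_step: "orbit (f x) = orbit x" if "x \<in> X" for x
  proof
    show "orbit (f x) \<subseteq> orbit x"
      unfolding orbit_def using shift by (auto simp del: funpow.simps) metis
    have "(f ^^ i) x = (f ^^ (i + (k - 1))) (f x)" for i
      using fk[OF that] by (simp add: funpow_add)
    then show "orbit x \<subseteq> orbit (f x)"
      unfolding orbit_def by blast
  qed
  have "even (d (f x)) \<longleftrightarrow> \<not> even (d x)" if "x \<in> X" for x
  proof -
    have rep_eq: "rep (f x) = rep x" using orbit_step[OF that] by (simp add: rep_def)
    have "x \<in> orbit x" unfolding orbit_def by (auto intro: exI[of _ 0])
    then have "rep x \<in> orbit x" unfolding rep_def by (rule someI)
    then have dx: "(f ^^ d x) x = rep x"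
      unfolding d_def orbit_def by (auto intro: LeastI)
    show ?thesis
    proof (cases "d x")
      case 0
      then have "rep x = x" using dx by simp
      have "d (f x) = k - 1"
        unfolding d_def
      proof (rule Least_equality)
        show "(f ^^ (k - 1)) (f x) = rep (f x)" using fk[OF that] rep_eq \<open>rep x = x\<close> by simp
        fix j assume "(f ^^ j) (f x) = rep (f x)"
        then have "(f ^^ Suc j) x = x" using rep_eq \<open>rep x = x\<close> by (simp only: shift)
        then show "k - 1 \<le> j"
          using orb[OF that] unfolding k_orbit_def by (metis Suc_lessI Suc_pred' \<open>0 < k\<close> less_diff_conv not_le zero_less_Suc Suc_eq_plus1)
      qed
      then show ?thesis using 0 \<open>even k\<close> \<open>k > 0\<close> by simp
    next
      case (Suc j)
      have "d (f x) = j"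
        unfolding d_def
      proof (rule Least_equality)
        show "(f ^^ j) (f x) = rep (f x)" using dx Suc rep_eq by (simp only: shift)
        fix i assume "(f ^^ i) (f x) = rep (f x)"
        then have "(f ^^ Suc i) x = rep x" using rep_eq by (simp only: shift)
        then have "d x \<le> Suc i" unfolding d_def by (rule Least_le)
        then show "j \<le> i" using Suc by simp
      qed
      then show ?thesis using Suc by simp
    qed
  qed
  then show ?thesis by (intro exI[of _ "\<lambda>x. even (d x)"]) blast
qed

text \<open>The permutation \<open>\<sigma> v\<close> is the near-factor missing \<open>v\<close>, its cycles being oriented. Injectivity of
  \<open>v \<mapsto> \<sigma> v x\<close> says that no arc occurs twice; by counting, every arc \<open>(x, y)\<close> with \<open>x \<noteq> y\<close> then
  occurs exactly once.\<close>

definition near_factors :: "nat \<Rightarrow> 'a set \<Rightarrow> ('a \<Rightarrow> 'a \<Rightarrow> 'a) \<Rightarrow> bool" where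
  "near_factors k V \<sigma> \<longleftrightarrow>
     (\<forall>v\<in>V. \<forall>x\<in>V. \<sigma> v x \<in> V) \<and> (\<forall>v\<in>V. \<sigma> v v = v) \<and>
     (\<forall>x\<in>V. inj_on (\<lambda>v. \<sigma> v x) V) \<and> (\<forall>v\<in>V. \<forall>x\<in>V - {v}. k_orbit k (\<sigma> v) x)"

text \<open>The point \<open>v\<close> is fixed, so a walk that reached it could not return to
  \<open>x\<close>.\<close>

lemma near_factors_neq:
  assumes "near_factors k V \<sigma>" and "v \<in> V" and "x \<in> V" and "x \<noteq> v" and "k > 0"
  shows "\<sigma> v x \<noteq> v"
proof
  assume "\<sigma> v x = v"
  moreover have fix_v: "(\<sigma> v ^^ i) v = v" for i
    using assms unfolding near_factors_def by (induction i) auto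
  ultimately have "(\<sigma> v ^^ (k - 1)) (\<sigma> v x) = v" by simp
  then have "(\<sigma> v ^^ k) x = v" using \<open>k > 0\<close> by (metis Suc_diff_1 comp_apply funpow_Suc_right)
  then show False using assms unfolding near_factors_def k_orbit_def by auto
qed

text \<open>Conjugation by a bijection. Only the number of vertices matters, so each construction
  may use the vertex set that suits it.\<close>

lemma near_factors_transfer:
  fixes V :: "'a set" and W :: "'b set"
  assumes nf: "near_factors k V \<sigma>" and "finite V" and "finite W" and "card W = card V"
  shows "\<exists>\<rho>. near_factors k W \<rho>"
proof -
  obtain h where h: "bij_betw h V W"
    using assms by (metis finite_same_card_bij)
  define h' where "h' = inv_into V h"
  have inv: "\<And>x. x \<in> V \<Longrightarrow> h' (h x) = x" "\<And>y. y \<in> W \<Longrightarrow> h (h' y) = y" "\<And>y. y \<in> W \<Longrightarrow> h' y \<in> V"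
    "\<And>x. x \<in> V \<Longrightarrow> h x \<in> W"
    using h unfolding h'_def bij_betw_def by (auto simp: f_inv_into_f inv_into_into)
  define \<rho> where "\<rho> v x = h (\<sigma> (h' v) (h' x))" for v x
  have "near_factors k W \<rho>"
    unfolding near_factors_def
  proof (intro conjI ballI)
    fix v x assume "v \<in> W" "x \<in> W"
    then show "\<rho> v x \<in> W" using nf inv unfolding \<rho>_def near_factors_def by auto
  next
    fix v assume "v \<in> W" then show "\<rho> v v = v" using nf inv unfolding \<rho>_def near_factors_def by auto
  next
    fix x assume x: "x \<in> W"
    show "inj_on (\<lambda>v. \<rho> v x) W"
    proof (rule inj_onI)
      fix v w assume vw: "v \<in> W" "w \<in> W" "\<rho> v x = \<rho> w x"
      then have "\<sigma> (h' v) (h' x) = \<sigma> (h' w) (h' x)"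
        using nf inv x unfolding \<rho>_def near_factors_def by metis
      then have "h' v = h' w" using nf inv x vw unfolding near_factors_def by (meson inj_onD)
      then show "v = w" using inv vw by metis
    qed
  next
    fix v x assume v: "v \<in> W" and x: "x \<in> W - {v}"
    then have "h' x \<in> V - {h' v}" using inv by (metis DiffD1 DiffD2 DiffI singletonD singletonI)
    then have "k_orbit k (\<sigma> (h' v)) (h' x)" using nf inv v unfolding near_factors_def by blast
    then have "k_orbit k (\<rho> v) (h (h' x))"
      by (rule k_orbit_transfer[where X = V])
        (use nf inv v x h in \<open>auto simp: near_factors_def \<rho>_def bij_betw_def\<close>)
    then show "k_orbit k (\<rho> v) x" using inv x by simp
  qed
  then show ?thesis by blast
qed

section \<open>Filling frames\<close>

text \<open>The analogue of \<open>near_factors\<close> for the complete multipartite digraph with parts \<open>{i} \<times> W\<close>: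
  the factor \<open>\<tau> (i, w)\<close> misses the whole part over \<open>i\<close>.\<close>

definition frame_factors ::
    "nat \<Rightarrow> 'i set \<Rightarrow> 'w set \<Rightarrow> ('i \<times> 'w \<Rightarrow> 'i \<times> 'w \<Rightarrow> 'i \<times> 'w) \<Rightarrow> bool" where
  "frame_factors k I W \<tau> \<longleftrightarrow>
     (\<forall>i\<in>I. \<forall>w\<in>W. \<forall>j\<in>I - {i}. \<forall>x\<in>W. \<tau> (i, w) (j, x) \<in> (I - {i, j}) \<times> W) \<and>
     (\<forall>j\<in>I. \<forall>x\<in>W. inj_on (\<lambda>v. \<tau> v (j, x)) ((I - {j}) \<times> W)) \<and>
     (\<forall>i\<in>I. \<forall>w\<in>W. \<forall>j\<in>I - {i}. \<forall>x\<in>W. k_orbit k (\<tau> (i, w)) (j, x))"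

text \<open>The factor missing a point of group \<open>i\<close> joins a frame factor outside that
  group with a copy of a factor of \<open>\<sigma>\<close> on the group and \<open>None\<close>; the
  factor missing \<open>None\<close> is the union of the copies of \<open>\<sigma> None\<close>.
  Arcs between groups come from \<open>\<tau>\<close> alone, all others from \<open>\<sigma>\<close>
  alone.\<close>

lemma near_factors_fill_frame:
  assumes fr: "frame_factors k I W \<tau>" and nf: "near_factors k (insert None (Some ` W)) \<sigma>" and "k > 0"
  shows "\<exists>\<rho>. near_factors k (insert None (Some ` (I \<times> W))) \<rho>"
proof -
  define \<rho> where "\<rho> v x = (case v of
      None \<Rightarrow> (case x of None \<Rightarrow> None | Some (j, y) \<Rightarrow> map_option (Pair j) (\<sigma> None (Some y)))
    | Some (i, w) \<Rightarrow> (case x of None \<Rightarrow> map_option (Pair i) (\<sigma> (Some w) None)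
        | Some (j, y) \<Rightarrow> if j = i then map_option (Pair i) (\<sigma> (Some w) (Some y)) else Some (\<tau> (i, w) (j, y))))"
    for v x :: "('a \<times> 'b) option"
  let ?U = "insert None (Some ` W)" and ?V = "insert None (Some ` (I \<times> W))"
  have \<sigma>_in: "\<sigma> v x \<in> ?U" if "v \<in> ?U" "x \<in> ?U" for v x
    by (rule nf[unfolded near_factors_def, THEN conjunct1, rule_format, OF that])
  have \<sigma>_id: "\<sigma> v v = v" if "v \<in> ?U" for v
    by (rule nf[unfolded near_factors_def, THEN conjunct2, THEN conjunct1, rule_format, OF that])
  have \<sigma>_eqD: "v = w" if "\<sigma> v x = \<sigma> w x" "v \<in> ?U" "w \<in> ?U" "x \<in> ?U" for v w x
    by (rule inj_onD[OF nf[unfolded near_factors_def, THEN conjunct2, THEN conjunct2, THEN conjunct1,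
          rule_format, OF that(4)] that(1-3)])
  have \<sigma>_None: "\<sigma> None (Some y) \<in> Some ` W" if "y \<in> W" for y
    using \<sigma>_in[of None "Some y"] near_factors_neq[OF nf, of None "Some y"] that \<open>k > 0\<close> by auto
  have \<tau>_in: "\<tau> (i, w) (j, x) \<in> (I - {i, j}) \<times> W" if "i \<in> I" "w \<in> W" "j \<in> I" "j \<noteq> i" "x \<in> W" for i w j x
    using fr that unfolding frame_factors_def by blast
  have emb: "map_option (Pair i) z \<in> insert None (Some ` ({i} \<times> W))" if "z \<in> ?U" for i z
    using that by auto
  have inj_emb: "inj (map_option (Pair i))" for i :: 'a
    by (rule option.inj_map) (simp add: inj_def)
  have emb_eq: "map_option (Pair i) z = map_option (Pair i) z' \<longleftrightarrow> z = z'" for i :: 'a and z z' :: "'b option"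
    using inj_emb[of i] by (auto simp: inj_def)
  \<comment> \<open>The copies over different groups overlap only at \<open>v = x = None\<close>,
    where \<open>\<sigma> None None = None\<close> makes them agree.\<close>
  have same: "\<rho> (map_option (Pair i) v) (map_option (Pair i) x) = map_option (Pair i) (\<sigma> v x)"
    if "v \<in> ?U" "x \<in> ?U" for i v x
    using that \<sigma>_id[of None] by (auto simp: \<rho>_def)
  have other: "\<rho> (Some (i, w)) (Some (j, y)) = Some (\<tau> (i, w) (j, y))" if "i \<noteq> j" for i w j y
    using that by (simp add: \<rho>_def)
  have "near_factors k ?V \<rho>"
    unfolding near_factors_def
  proof (intro conjI ballI)
    fix v x assume "v \<in> ?V" "x \<in> ?V"
    have emb': "map_option (Pair i) z \<in> ?V" if "z \<in> ?U" "i \<in> I" for i z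
      using that by auto
    then show "\<rho> v x \<in> ?V"
    proof (cases v)
      case None
      show ?thesis
      proof (cases x)
        case None then show ?thesis by (simp add: \<rho>_def \<open>v = None\<close>)
      next
        case (Some p)
        then show ?thesis using \<open>x \<in> ?V\<close> \<open>v = None\<close> emb'[OF \<sigma>_in] by (auto simp: \<rho>_def)
      qed
    next
      case (Some p)
      then obtain i w where v: "v = Some (i, w)" "i \<in> I" "w \<in> W" using \<open>v \<in> ?V\<close> by auto
      show ?thesis
      proof (cases x)
        case None then show ?thesis using v emb'[OF \<sigma>_in] by (auto simp: \<rho>_def)
      next
        case (Some q)
        then obtain j y where "x = Some (j, y)" "j \<in> I" "y \<in> W" using \<open>x \<in> ?V\<close> by auto
        then show ?thesis using v emb'[OF \<sigma>_in] \<tau>_in[of i w j y] by (auto simp: \<rho>_def)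
      qed
    qed
  next
    fix v assume "v \<in> ?V"
    then show "\<rho> v v = v" using \<sigma>_id by (auto simp: \<rho>_def)
  next
    fix x assume "x \<in> ?V"
    show "inj_on (\<lambda>v. \<rho> v x) ?V"
    proof (cases x)
      case None
      have "\<rho> v x = v" if "v \<in> ?V" "\<rho> v x = None" for v
        using that \<sigma>_eqD[of _ None None] \<sigma>_id[of None] by (auto simp: \<rho>_def None split: option.splits)
      moreover have "v = w" if vw: "v \<in> ?V" "w \<in> ?V" "\<rho> v x = \<rho> w x" "\<rho> v x \<noteq> None" for v w
      proof -
        obtain i y j z where "v = Some (i, y)" "w = Some (j, z)" "y \<in> W" "z \<in> W"
          using vw by (cases v; cases w) (auto simp: \<rho>_def None)
        then show ?thesis using vw \<sigma>_eqD[of "Some y" None "Some z"] by (auto simp: \<rho>_def None)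
      qed
      ultimately show ?thesis by (intro inj_onI) metis
    next
      case (Some p)
      then obtain j y where x: "x = Some (j, y)" and jy: "j \<in> I" "y \<in> W" using \<open>x \<in> ?V\<close> by auto
      \<comment> \<open>A missed point in \<open>?S\<close> sends \<open>x\<close> into group
        \<open>j\<close> or to \<open>None\<close>, one in \<open>?T\<close> sends it to another
        group; so only points on the same side need comparing.\<close>
      let ?S = "map_option (Pair j) ` ?U" and ?T = "Some ` ((I - {j}) \<times> W)"
      have split: "?V \<subseteq> ?S \<union> ?T"
      proof
        fix v assume v: "v \<in> ?V"
        show "v \<in> ?S \<union> ?T"
        proof (cases v)
          case None then show ?thesis by (auto intro: image_eqI[of _ _ None])
        next
          case (Some p)
          then obtain i w where "v = Some (i, w)" "i \<in> I" "w \<in> W" using v by auto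
          then show ?thesis by (cases "i = j") (auto intro: image_eqI[of _ _ "Some w"])
        qed
      qed
      have S: "\<rho> (map_option (Pair j) v) x = map_option (Pair j) (\<sigma> v (Some y))" if "v \<in> ?U" for v
        using same[OF that, of "Some y" j] jy x by simp
      have "inj_on (\<lambda>v. \<rho> v x) ?S"
      proof (rule inj_onI)
        fix v w assume "v \<in> ?S" "w \<in> ?S" "\<rho> v x = \<rho> w x"
        then obtain v' w' where "v' \<in> ?U" "w' \<in> ?U" "v = map_option (Pair j) v'" "w = map_option (Pair j) w'"
          by blast
        moreover from this have "\<sigma> v' (Some y) = \<sigma> w' (Some y)"
          using \<open>\<rho> v x = \<rho> w x\<close> S emb_eq by metis
        ultimately show "v = w" using \<sigma>_eqD[of v' "Some y" w'] jy by simp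
      qed
      moreover have "inj_on (\<lambda>v. \<rho> v x) ?T"
      proof -
        have "inj_on (\<lambda>v. \<tau> v (j, y)) ((I - {j}) \<times> W)" using fr jy unfolding frame_factors_def by blast
        then show ?thesis using other x by (auto simp: inj_on_def)
      qed
      moreover have "\<rho> v x \<noteq> \<rho> w x" if v: "v \<in> ?S" and w: "w \<in> ?T" for v w
      proof -
        obtain v' where "v' \<in> ?U" "v = map_option (Pair j) v'" using v by blast
        then have "\<rho> v x \<in> insert None (Some ` ({j} \<times> W))"
          using S emb[OF \<sigma>_in, of v' "Some y" j] jy by (simp only: insertI2 imageI)
        moreover obtain i z where "w = Some (i, z)" "i \<in> I" "i \<noteq> j" "z \<in> W" using w by auto
        then have "\<rho> w x = Some (\<tau> (i, z) (j, y))" "\<tau> (i, z) (j, y) \<in> (I - {i, j}) \<times> W"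
          using other x \<tau>_in jy by auto
        ultimately show ?thesis by fastforce
      qed
      ultimately have "inj_on (\<lambda>v. \<rho> v x) (?S \<union> ?T)" unfolding inj_on_Un by blast
      then show ?thesis using split inj_on_subset by blast
    qed
  next
    fix v x assume v: "v \<in> ?V" and x: "x \<in> ?V - {v}"
    show "k_orbit k (\<rho> v) x"
    proof (cases v)
      case None
      then obtain j y where xj: "x = map_option (Pair j) (Some y)" "y \<in> W" using x by auto
      have orb: "k_orbit k (\<sigma> None) (Some y)" using nf xj unfolding near_factors_def by auto
      show ?thesis
        unfolding xj(1)
        by (rule k_orbit_transfer[OF orb, where X = "Some ` W"])
          (use xj \<sigma>_None same[of None _ j] None inj_on_subset[OF inj_emb subset_UNIV] in \<open>auto\<close>)
    next
      case (Some p)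
      then obtain i w where vi: "v = Some (i, w)" "i \<in> I" "w \<in> W" using v by auto
      \<comment> \<open>The points of group \<open>i\<close> and \<open>None\<close> lie on copied
        cycles of \<open>\<sigma>\<close>, all others on cycles of the frame.\<close>
      show ?thesis
      proof (cases "\<exists>x'\<in>?U. x = map_option (Pair i) x'")
        case True
        then obtain x' where x': "x' \<in> ?U" "x = map_option (Pair i) x'" by blast
        then have "x' \<noteq> Some w" using x vi by auto
        then have orb: "k_orbit k (\<sigma> (Some w)) x'" using nf x' vi unfolding near_factors_def by auto
        show ?thesis
          unfolding x'(2)
        proof (rule k_orbit_transfer[OF orb x'(1)])
          show "inj_on (map_option (Pair i)) ?U" using inj_emb inj_on_subset by blast
          show "\<sigma> (Some w) y \<in> ?U" if "y \<in> ?U" for y using \<sigma>_in[OF _ that] vi by simp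
          show "\<rho> v (map_option (Pair i) y) = map_option (Pair i) (\<sigma> (Some w) y)" if "y \<in> ?U" for y
            using same[OF _ that, of "Some w" i] vi by simp
        qed
      next
        case False
        obtain j y where xj: "x = Some (j, y)" "j \<in> I" "y \<in> W" using x False by (cases x) auto
        have "j \<noteq> i" using False xj by auto
        then have orb: "k_orbit k (\<tau> (i, w)) (j, y)" using fr vi xj unfolding frame_factors_def by blast
        show ?thesis
          unfolding xj(1)
        proof (rule k_orbit_transfer[OF orb, where X = "(I - {i}) \<times> W"])
          fix q assume "q \<in> (I - {i}) \<times> W"
          then obtain a y where q: "q = (a, y)" "a \<in> I" "a \<noteq> i" "y \<in> W" by blast
          show "\<tau> (i, w) q \<in> (I - {i}) \<times> W"
            unfolding q(1) using \<tau>_in[OF vi(2,3) q(2-4)] by (auto simp: mem_Times_iff)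
          show "\<rho> v (Some q) = Some (\<tau> (i, w) q)"
            unfolding q(1) vi(1) by (rule other[OF q(3)[symmetric]])
        qed (use xj \<open>j \<noteq> i\<close> in simp_all)
      qed
    qed
  qed
  then show ?thesis by blast
qed

section \<open>Frames from one-factorizations with holes\<close>

text \<open>A one-factorization of the complete graph on \<open>I \<times> {False, True}\<close> minus the
  perfect matching of the pairs \<open>{(i, False), (i, True)}\<close>, in which the factor
  \<open>\<pi> (i, c)\<close> misses exactly the two points over \<open>i\<close>.\<close>

definition holey_matching ::
    "nat set \<Rightarrow> (nat \<times> bool \<Rightarrow> nat \<times> bool \<Rightarrow> nat \<times> bool) \<Rightarrow> bool" where
  "holey_matching I \<pi> \<longleftrightarrow>
     (\<forall>i\<in>I. \<forall>c. \<forall>j\<in>I - {i}. \<forall>b.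
        fst (\<pi> (i, c) (j, b)) \<in> I - {i, j} \<and> \<pi> (i, c) (\<pi> (i, c) (j, b)) = (j, b)) \<and>
     (\<forall>j\<in>I. \<forall>b. \<forall>i\<in>I - {j}. \<forall>c. \<forall>i'\<in>I - {j}. \<forall>c'.
        \<pi> (i, c) (j, b) = \<pi> (i', c') (j, b) \<longrightarrow> i = i' \<and> c = c')"

lemma mod_add_left_eqD:
  fixes y a b t :: nat
  assumes "(y + a) mod t = (y + b) mod t" and "a < b + t" and "b < a + t"
  shows "a = b"
proof -
  have "[a = b] (mod t)" using assms(1) by (metis cong_add_lcancel_nat cong_def)
  then have "int t dvd int a - int b" by (simp add: cong_int_iff[symmetric] cong_iff_dvd_diff)
  moreover have "\<bar>int a - int b\<bar> < int t" using assms(2,3) by linarith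
  ultimately have "int a - int b = 0" using zdvd_not_zless[of "\<bar>int a - int b\<bar>" "int t"] by force
  then show ?thesis by simp
qed

text \<open>Each matched pair of halves is blown up to a complete bipartite digraph on
  \<open>\<int>\<^sub>m \<times> \<int>\<^sub>t\<close>. The factor \<open>(e, f)\<close> goes forward by \<open>(e, f)\<close> and back by \<open>-(e + 1, f)\<close>, so two steps
  subtract 1 from the first coordinate, which gives cycles of length \<open>2 m\<close>. The half with the
  smaller index counts as the forward side.\<close>

lemma frame_factors_holey_matching:
  fixes m t :: nat
  assumes hm: "holey_matching I \<pi>" and "m \<ge> 1" and "t \<ge> 1"
  shows "\<exists>\<tau>. frame_factors (2 * m) I ((UNIV :: bool set) \<times> {..<m} \<times> {..<t}) \<tau>"
proof -
  define \<tau> where "\<tau> v p = (case v of (i, c, e, f) \<Rightarrow> case p of (j, b, x, y) \<Rightarrow>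
      (case \<pi> (i, c) (j, b) of (j', b') \<Rightarrow>
        (j', b', if j < j' then ((x + e) mod m, (y + f) mod t)
                 else ((x + (m - 1 - e)) mod m, (y + (t - f)) mod t))))"
    for v p :: "nat \<times> bool \<times> nat \<times> nat"
  let ?W = "(UNIV :: bool set) \<times> {..<m} \<times> {..<t}"
  have fst\<tau>: "fst (\<tau> (i, c, e, f) (j, b, x, y)) = fst (\<pi> (i, c) (j, b))" for i c e f j b x y
    by (simp add: \<tau>_def split: prod.splits)
  have in\<tau>: "\<tau> (i, w) (j, x) \<in> (I - {i, j}) \<times> ?W"
    if "i \<in> I" "w \<in> ?W" "j \<in> I - {i}" "x \<in> ?W" for i w j x
  proof -
    obtain c e f b x' y where eq: "w = (c, e, f)" "x = (b, x', y)" by (metis prod_cases3)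
    obtain j' b' where p: "\<pi> (i, c) (j, b) = (j', b')" by fastforce
    have "j' \<in> I - {i, j}" using hm that p unfolding holey_matching_def by (metis fst_conv)
    then show ?thesis using assms(2,3) by (simp add: \<tau>_def eq p)
  qed
  have "frame_factors (2 * m) I ?W \<tau>"
    unfolding frame_factors_def
  proof (intro conjI ballI)
    fix i w j x assume "i \<in> I" "w \<in> ?W" "j \<in> I - {i}" "x \<in> ?W"
    then show "\<tau> (i, w) (j, x) \<in> (I - {i, j}) \<times> ?W" by (rule in\<tau>)
  next
    fix j z assume j: "j \<in> I" and "z \<in> ?W"
    then obtain b x y where z: "z = (b, x, y)" "x < m" "y < t" by auto
    show "inj_on (\<lambda>v. \<tau> v (j, z)) ((I - {j}) \<times> ?W)"
    proof (rule inj_onI)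
      fix v w assume v: "v \<in> (I - {j}) \<times> ?W" and w: "w \<in> (I - {j}) \<times> ?W"
        and eq: "\<tau> v (j, z) = \<tau> w (j, z)"
      obtain i c e f where v': "v = (i, c, e, f)" "i \<in> I - {j}" "e < m" "f < t" using v by auto
      obtain i' c' e' f' where w': "w = (i', c', e', f')" "i' \<in> I - {j}" "e' < m" "f' < t" using w by auto
      \<comment> \<open>The half containing the target determines the matching, hence
        \<open>(i, c)\<close>; the displacement then determines \<open>(e, f)\<close> in either
        direction.\<close>
      have "\<pi> (i, c) (j, b) = \<pi> (i', c') (j, b)"
        using eq by (auto simp: \<tau>_def v' w' z split: prod.splits)
      then have ic: "(i, c) = (i', c')"
        using hm j v' w' unfolding holey_matching_def by blast
      obtain j' b' where p: "\<pi> (i, c) (j, b) = (j', b')" by fastforce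
      show "v = w"
      proof (cases "j < j'")
        case True
        then have "(x + e) mod m = (x + e') mod m" "(y + f) mod t = (y + f') mod t"
          using eq ic p by (auto simp: \<tau>_def v' w' z)
        then show ?thesis
          using v' w' ic mod_add_left_eqD[of x e m e'] mod_add_left_eqD[of y f t f'] by auto
      next
        case False
        then have "(x + (m - 1 - e)) mod m = (x + (m - 1 - e')) mod m"
          "(y + (t - f)) mod t = (y + (t - f')) mod t"
          using eq ic p by (auto simp: \<tau>_def v' w' z)
        then have "m - 1 - e = m - 1 - e'" "t - f = t - f'"
          using v' w' by (auto intro: mod_add_left_eqD)
        then show ?thesis using v' w' ic by auto
      qed
    qed
  next
    fix i w j z assume i: "i \<in> I" and "w \<in> ?W" and j: "j \<in> I - {i}" and "z \<in> ?W"
    then obtain c e f b x y where w: "w = (c, e, f)" "e < m" "f < t" and z: "z = (b, x, y)" "x < m" "y < t"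
      by auto
    obtain j' b' where p: "\<pi> (i, c) (j, b) = (j', b')" by fastforce
    have p': "\<pi> (i, c) (j', b') = (j, b)" and "j' \<noteq> j"
      using hm i j p unfolding holey_matching_def by (metis, metis Diff_iff fst_conv insertCI)
    \<comment> \<open>Whichever half comes first, the two displacements add up to
      \<open>m - 1\<close>, that is -1, modulo \<open>m\<close> and to 0 modulo
      \<open>t\<close>.\<close>
    have two: "\<tau> (i, w) (\<tau> (i, w) (j, b, x', y)) = (j, b, (x' + (m - 1)) mod m, y)" for x'
    proof -
      have "((x' + e) mod m + (m - 1 - e)) mod m = (x' + (m - 1)) mod m"
        "((x' + (m - 1 - e)) mod m + e) mod m = (x' + (m - 1)) mod m"
        "((y + f) mod t + (t - f)) mod t = y" "((y + (t - f)) mod t + f) mod t = y"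
        unfolding mod_add_left_eq using w z by simp_all
      then show ?thesis using \<open>j' \<noteq> j\<close> by (simp add: \<tau>_def p p' w)
    qed
    have iter: "(\<tau> (i, w) ^^ (2 * n)) (j, z) = (j, b, (x + n * (m - 1)) mod m, y)" for n
    proof (induction n)
      case (Suc n)
      have "(\<tau> (i, w) ^^ (2 * Suc n)) (j, z) = \<tau> (i, w) (\<tau> (i, w) ((\<tau> (i, w) ^^ (2 * n)) (j, z)))"
        by simp
      also have "\<dots> = (j, b, (x + Suc n * (m - 1)) mod m, y)"
        unfolding Suc two by (simp add: mod_simps add_ac)
      finally show ?case .
    qed (simp add: z)
    show "k_orbit (2 * m) (\<tau> (i, w)) (j, z)"
      unfolding k_orbit_def
    proof (intro conjI allI impI)
      show "(\<tau> (i, w) ^^ (2 * m)) (j, z) = (j, z)" unfolding iter using z by simp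
      fix n assume n: "0 < n \<and> n < 2 * m"
      \<comment> \<open>Odd iterates lie over \<open>j'\<close>; the even one with
        \<open>n = 2 * l\<close> shifts \<open>x\<close> by \<open>-l\<close>, which is nonzero
        modulo \<open>m\<close> as \<open>0 < l < m\<close>.\<close>
      show "(\<tau> (i, w) ^^ n) (j, z) \<noteq> (j, z)"
      proof (cases "even n")
        case True
        then obtain l where l: "n = 2 * l" by blast
        have "(x + l * (m - 1)) mod m \<noteq> x"
        proof
          assume a: "(x + l * (m - 1)) mod m = x"
          have "(x + l) mod m = ((x + l * (m - 1)) mod m + l) mod m" using a by simp
          also have "\<dots> = (x + (l * (m - 1) + l)) mod m" by (simp add: mod_add_left_eq add.assoc)
          also have "l * (m - 1) + l = l * m" using \<open>m \<ge> 1\<close> by (cases m) auto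
          finally have "(x + l) mod m = (x + 0) mod m" by simp
          then show False using mod_add_left_eqD[of x l m 0] n l by simp
        qed
        then show ?thesis unfolding l iter using z by simp
      next
        case False
        then obtain l where l: "n = Suc (2 * l)" by (metis oddE Suc_eq_plus1)
        have "fst ((\<tau> (i, w) ^^ n) (j, z)) = j'"
          unfolding l funpow.simps comp_apply iter by (simp add: w fst\<tau> p)
        then show ?thesis using \<open>j' \<noteq> j\<close> by auto
      qed
    qed
  qed
  then show ?thesis by blast
qed

text \<open>Reflect the residues modulo \<open>s\<close> at \<open>i\<close>, swapping the halves
  iff \<open>c\<close> is true. As doubling is injective for odd \<open>s\<close>, only
  \<open>i\<close> is fixed, and \<open>i\<close> is recovered from a point and its image.\<close>

lemma holey_matching_odd:
  assumes "odd s"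
  shows "\<exists>\<pi>. holey_matching {..<s} \<pi>"
proof -
  define r where "r i j = (2 * i + (s - j)) mod s" for i j
  define \<pi> where "\<pi> h p = (case h of (i, c) \<Rightarrow> case p of (j, b) \<Rightarrow> (r i j, b \<noteq> c))"
    for h p :: "nat \<times> bool"
  have "s > 0" using assms by (cases s) auto
  have less: "r i j < s" for i j using \<open>s > 0\<close> by (simp add: r_def)
  have r: "[r i j + j = 2 * i] (mod s)" if "j < s" for i j
  proof -
    have "2 * i + (s - j) + j = 2 * i + s" using that by simp
    then show ?thesis by (metis cong_def mod_add_left_eq mod_add_self2 r_def)
  qed
  have half: "i = j" if "[2 * i = 2 * j] (mod s)" "i < s" "j < s" for i j
    using that assms by (metis cong_less_modulus_unique_nat cong_mult_lcancel_nat coprime_left_2_iff_odd coprime_commute)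
  have "r i j \<noteq> i" if "i < s" "j < s" "j \<noteq> i" for i j
  proof
    assume "r i j = i"
    then have "[i + j = i + i] (mod s)" using r[OF that(2), of i] by (simp add: mult_2)
    then show False using that by (metis cong_add_lcancel_nat cong_less_modulus_unique_nat)
  qed
  moreover have "r i j \<noteq> j" if "i < s" "j < s" "j \<noteq> i" for i j
    using r[OF that(2), of i] half[of j i] that by (auto simp: mult_2)
  moreover have "r i (r i j) = j" if "j < s" for i j
  proof -
    have "[r i (r i j) + r i j = j + r i j] (mod s)"
      using r[OF less, of i i j] r[OF that, of i] by (metis add.commute cong_sym cong_trans)
    then show ?thesis using that less by (metis cong_add_rcancel_nat cong_less_modulus_unique_nat)
  qed
  moreover have "i = i'" if "r i j = r i' j" "i < s" "i' < s" "j < s" for i i' j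
    using half[OF _ that(2,3)] r[OF that(4), of i] r[OF that(4), of i'] that(1) by (metis cong_sym cong_trans)
  ultimately have "holey_matching {..<s} \<pi>"
    unfolding holey_matching_def \<pi>_def by (simp add: less) blast
  then show ?thesis by blast
qed

text \<open>The translates in \<open>\<int>\<^sub>8\<close> of the starter \<open>{1, 2}, {5, 7}, {3, 6}\<close>, whose differences are
  \<open>\<plusminus>1, \<plusminus>2, \<plusminus>3\<close>; the residue \<open>i + 4 c\<close> is encoded as \<open>(i, c)\<close>.\<close>

lemma holey_matching_4: "\<exists>\<pi>. holey_matching {..<4} \<pi>"
proof -
  \<comment> \<open>Entry \<open>d\<close> of the list is the starter partner of \<open>d\<close>;
    the missed residues 0 and 4 are fixed.\<close>
  define T :: "nat \<Rightarrow> nat \<Rightarrow> nat" where "T h p = (h + [0, 2, 1, 6, 4, 7, 3, 5] ! ((p + 8 - h) mod 8)) mod 8" for h p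
  \<comment> \<open>For \<open>d\<close> other than 0 and 4, entry \<open>d\<close> is the starter
    element whose partner exceeds it by \<open>d\<close> modulo 8. Subtracting it from
    \<open>p\<close> recovers the translation \<open>h\<close>.\<close>
  define S :: "nat \<Rightarrow> nat \<Rightarrow> nat" where "S p q = (p + 8 - [0, 1, 5, 3, 0, 6, 7, 2] ! ((q + 8 - p) mod 8)) mod 8" for p q
  have "\<forall>h\<in>{..<8}. \<forall>p\<in>{..<8}. h mod 4 \<noteq> p mod 4 \<longrightarrow>
      T h p < 8 \<and> T h p mod 4 \<noteq> h mod 4 \<and> T h p mod 4 \<noteq> p mod 4 \<and> T h (T h p) = p \<and> S p (T h p) = h"
    unfolding T_def S_def by code_simp
  then have T: "T h p < 8" "T h p mod 4 \<noteq> h mod 4" "T h p mod 4 \<noteq> p mod 4" "T h (T h p) = p" "S p (T h p) = h"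
    if "h < 8" "p < 8" "h mod 4 \<noteq> p mod 4" for h p using that by auto
  define enc :: "nat \<times> bool \<Rightarrow> nat" where "enc h = fst h + (if snd h then 4 else 0)" for h
  define dec :: "nat \<Rightarrow> nat \<times> bool" where "dec y = (y mod 4, 4 \<le> y)" for y
  have enc: "enc (i, c) < 8" "enc (i, c) mod 4 = i" "dec (enc (i, c)) = (i, c)" if "i < 4" for i c
    using that by (auto simp: enc_def dec_def)
  have dec: "enc (dec y) = y" if "y < 8" for y
    using that by (auto simp: enc_def dec_def) presburger
  have fst_dec: "fst (dec y) = y mod 4" for y by (simp add: dec_def)
  define \<pi> where "\<pi> h p = dec (T (enc h) (enc p))" for h p
  have "fst (\<pi> (i, c) (j, b)) \<in> {..<4} - {i, j} \<and> \<pi> (i, c) (\<pi> (i, c) (j, b)) = (j, b)"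
    if "i < 4" "j < 4" "i \<noteq> j" for i j c b
    using T[of "enc (i, c)" "enc (j, b)"] enc[of i c] enc[of j b] that by (simp add: \<pi>_def dec fst_dec)
  moreover have "i = i' \<and> c = c'"
    if "\<pi> (i, c) (j, b) = \<pi> (i', c') (j, b)" "i < 4" "j < 4" "i' < 4" "i \<noteq> j" "i' \<noteq> j" for i i' j c c' b
  proof -
    have "T (enc (i, c)) (enc (j, b)) = T (enc (i', c')) (enc (j, b))"
      using that T(1)[of "enc (i, c)" "enc (j, b)"] T(1)[of "enc (i', c')" "enc (j, b)"] enc dec
      unfolding \<pi>_def by metis
    then have "enc (i, c) = enc (i', c')"
      using that T(5)[of "enc (i, c)" "enc (j, b)"] T(5)[of "enc (i', c')" "enc (j, b)"] enc by metis
    then show ?thesis using that enc by (metis Pair_inject)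
  qed
  ultimately have "holey_matching {..<4} \<pi>" unfolding holey_matching_def by simp
  then show ?thesis by blast
qed

section \<open>Two difference constructions\<close>

lemma mod_eq_cases:
  fixes a b n :: int
  assumes "a mod n = b mod n" and "\<bar>a - b\<bar> < 2 * n"
  shows "a - b = 0 \<or> a - b = n \<or> a - b = - n"
proof -
  obtain q where q: "a - b = n * q" using assms(1) by (metis mod_eq_dvd_iff dvdE)
  have "n > 0" using assms(2) by simp
  have "q < 2" using assms(2) q \<open>n > 0\<close>
    by (metis abs_less_iff mult.commute mult_less_cancel_left_pos)
  moreover have "- 2 < q"
  proof -
    have "n * (- q) < n * 2" using assms(2) q by (simp add: abs_less_iff mult.commute)
    then show ?thesis using \<open>n > 0\<close> mult_less_cancel_left_pos[of n "- q" 2] by linarith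
  qed
  ultimately have "q = 0 \<or> q = 1 \<or> q = - 1" by linarith
  then show ?thesis using q by auto
qed

lemma mod_eq_small:
  fixes a b n :: int
  assumes "a mod n = b mod n" and "\<bar>a - b\<bar> < n"
  shows "a = b"
proof -
  have "\<bar>a - b\<bar> < 2 * n" using assms(2) by linarith
  then show ?thesis using mod_eq_cases[OF assms(1)] assms(2) by auto
qed

text \<open>The point \<open>None\<close> is fixed by all translations of \<open>\<int>\<^bsub>2 m\<^esub>\<close>. The factor missing \<open>None\<close> is
  \<open>x \<mapsto> x + 1\<close>; the one missing \<open>0\<close> is the cycle \<open>None, 1, -1, 2, -2, \<dots>, m\<close>, whose differences
  \<open>-2, 3, -4, 5, \<dots>\<close> are all the nonzero residues except \<open>1\<close>.\<close>

lemma near_factors_one: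
  assumes "m \<ge> 2"
  shows "\<exists>\<sigma>. near_factors (2 * m) (insert None (Some ` {0..<2 * int m})) \<sigma>"
proof -
  define k where "k = 2 * int m"
  have k: "k \<ge> 4" "k = 2 * int m" using assms by (auto simp: k_def)
  \<comment> \<open>With \<open>d = x - v\<close>, the cycle goes from \<open>d\<close> to
    \<open>-d\<close> below \<open>m\<close>, from \<open>d\<close> to \<open>1 - d\<close> above
    \<open>m\<close>, and from \<open>m\<close> through \<open>None\<close> to 1;
    \<open>d = 0\<close> stays fixed.\<close>
  define \<sigma> where "\<sigma> v x = (case v of
      None \<Rightarrow> (case x of None \<Rightarrow> None | Some x \<Rightarrow> Some ((x + 1) mod k))
    | Some v \<Rightarrow> (case x of None \<Rightarrow> Some ((v + 1) mod k)
        | Some x \<Rightarrow> (let d = (x - v) mod k in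
            if d = int m then None
            else Some ((x + (if d < int m then - 2 * d else 1 - 2 * d)) mod k))))" for v x :: "int option"
  let ?V = "insert None (Some ` {0..<k})"
  have "near_factors (2 * m) ?V \<sigma>"
    unfolding near_factors_def
  proof (intro conjI ballI)
    fix v x assume "v \<in> ?V" "x \<in> ?V"
    then show "\<sigma> v x \<in> ?V" using k by (auto simp: \<sigma>_def Let_def split: option.splits)
  next
    fix v assume "v \<in> ?V"
    then show "\<sigma> v v = v" using k by (auto simp: \<sigma>_def Let_def split: option.splits)
  next
    fix x assume x: "x \<in> ?V"
    show "inj_on (\<lambda>v. \<sigma> v x) ?V"
    proof (cases x)
      case None
      have suc: "v = w" if "(v + 1) mod k = (w + 1) mod k" "v \<in> {0..<k}" "w \<in> {0..<k}" for v w
        using mod_eq_cases[OF that(1)] that by auto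
      show ?thesis
      proof (rule inj_onI)
        fix v w assume "v \<in> ?V" "w \<in> ?V" "\<sigma> v x = \<sigma> w x"
        then show "v = w" by (cases v; cases w) (auto simp: \<sigma>_def None intro: suc)
      qed
    next
      case (Some y)
      define d where "d v = (y - v) mod k" for v
      define r where "r v = (if d v < int m then - 2 * d v else 1 - 2 * d v)" for v
      have d: "0 \<le> d v" "d v < k" for v using k by (auto simp: d_def)
      have \<sigma>: "\<sigma> (Some v) x = (if d v = int m then None else Some ((y + r v) mod k))" for v
        by (simp add: \<sigma>_def Some Let_def d_def r_def)
      have \<sigma>_None: "\<sigma> None x = Some ((y + 1) mod k)" by (simp add: \<sigma>_def Some)
      have d_eqD: "v = w" if "d v = d w" "v \<in> {0..<k}" "w \<in> {0..<k}" for v w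
        using mod_eq_small[OF that(1)[unfolded d_def]] that(2,3) by auto
      \<comment> \<open>Displacement 1 is reserved for the factor missing \<open>None\<close>:
        \<open>- 2 * d\<close> is even, and \<open>1 - 2 * d\<close> is 1 modulo \<open>k\<close>
        only if \<open>d\<close> is 0 or \<open>m\<close>.\<close>
      have 1: "(y + r v) mod k \<noteq> (y + 1) mod k" if "d v \<noteq> int m" for v
      proof
        assume "(y + r v) mod k = (y + 1) mod k"
        moreover have "\<bar>(y + r v) - (y + 1)\<bar> < 2 * k"
          using d[of v] that k by (auto simp: r_def)
        ultimately have "r v - 1 = 0 \<or> r v - 1 = k \<or> r v - 1 = - k" using mod_eq_cases by fastforce
        moreover have "r v = - 2 * d v \<and> d v < int m \<or> r v = 1 - 2 * d v \<and> d v > int m"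
          using that by (auto simp: r_def)
        ultimately show False using d[of v] k by presburger
      qed
      \<comment> \<open>As \<open>k\<close> is even, the parity of \<open>r\<close> reveals the
        branch; within a branch, two values of \<open>2 * d\<close> differ by less than
        \<open>k\<close>.\<close>
      have 2: "v = w" if "(y + r v) mod k = (y + r w) mod k" "d v \<noteq> int m" "d w \<noteq> int m"
        "v \<in> {0..<k}" "w \<in> {0..<k}" for v w
      proof (rule d_eqD)
        have "\<bar>(y + r v) - (y + r w)\<bar> < 2 * k"
          using d[of v] d[of w] that(2,3) k by (auto simp: r_def)
        then have diff: "r v - r w = 0 \<or> r v - r w = k \<or> r v - r w = - k"
          using mod_eq_cases[OF that(1)] by simp
        then have "even (r v - r w)" by (metis dvd_0_right dvd_triv_left even_minus k(2))
        then have "d v < int m \<longleftrightarrow> d w < int m" by (auto simp: r_def split: if_splits)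
        then show "d v = d w" using diff d[of v] d[of w] that(2,3) k by (auto simp: r_def split: if_splits)
      qed (use that in auto)
      show ?thesis
      proof (rule inj_onI)
        fix v w assume "v \<in> ?V" "w \<in> ?V" "\<sigma> v x = \<sigma> w x"
        then show "v = w"
          using 1 by (cases v; cases w) (auto simp: \<sigma> \<sigma>_None split: if_splits intro: 2 d_eqD dest: sym)
      qed
    qed
  next
    fix v x assume v: "v \<in> ?V" and x: "x \<in> ?V - {v}"
    show "k_orbit (2 * m) (\<sigma> v) x"
    proof (cases v)
      case None
      then obtain y where y: "x = Some y" "y \<in> {0..<k}" using x by auto
      define e where "e i = Some ((y + int i) mod k)" for i
      have "k_orbit (2 * m) (\<sigma> v) (e 0)"
      proof (rule k_orbit_enumI)
        fix i assume "i < 2 * m"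
        show "\<sigma> v (e i) = e (Suc i mod (2 * m))"
        proof (cases "Suc i = 2 * m")
          case True
          then have eq: "y + int i + 1 = y + k" using k by simp
          have "(y + int i + 1) mod k = y mod k" unfolding eq by simp
          then show ?thesis using True by (simp add: e_def \<sigma>_def None mod_simps)
        next
          case False
          then show ?thesis using \<open>i < 2 * m\<close> by (simp add: e_def \<sigma>_def None mod_simps ac_simps)
        qed
      next
        show "inj_on e {..<2 * m}"
        proof (rule inj_onI)
          fix i j assume "i \<in> {..<2 * m}" "j \<in> {..<2 * m}" "e i = e j"
          then have "(y + int i) mod k = (y + int j) mod k" "\<bar>(y + int i) - (y + int j)\<bar> < k"
            using k by (auto simp: e_def)
          then have "y + int i = y + int j" by (rule mod_eq_small)
          then show "i = j" by simp
        qed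
      qed (use assms in simp)
      then show ?thesis using y by (simp add: e_def)
    next
      case (Some w)
      then have w: "w \<in> {0..<k}" using v by auto
      \<comment> \<open>Entry 0 of the cycle is \<open>None\<close>; entry \<open>i > 0\<close> has
        offset \<open>p i\<close> from \<open>w\<close>, running through 1, -1, 2, -2, and so on up
        to \<open>m\<close>.\<close>
      define p where "p i = (if odd i then (int i + 1) div 2 else - (int i div 2))" for i :: nat
      define e where "e i = (if i = 0 then None else Some ((w + p i) mod k))" for i
      have step: "\<sigma> v (e i) = e (Suc i mod (2 * m))" if i: "i < 2 * m" for i
      proof (cases "i = 0")
        case True
        then show ?thesis using assms by (simp add: e_def p_def \<sigma>_def Some)
      next
        case False
        define d where "d = ((w + p i) mod k - w) mod k"
        have \<sigma>e: "\<sigma> v (e i) = (if d = int m then None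
            else Some ((w + p i + (if d < int m then - 2 * d else 1 - 2 * d)) mod k))"
          using False by (simp only: \<sigma>_def e_def Some Let_def option.case if_False d_def[symmetric] mod_add_left_eq)
        have "d = p i mod k" unfolding d_def by (simp add: mod_simps)
        then have d: "d = (if odd i then (int i + 1) div 2 else k - int i div 2)"
          using i False k by (auto simp: p_def zmod_zminus1_eq_if)
        show ?thesis
        proof (cases "odd i")
          case True
          show ?thesis
          proof (cases "Suc i = 2 * m")
            case True
            then have "d = int m" using d \<open>odd i\<close> by simp
            then show ?thesis using True by (simp add: \<sigma>e) (simp add: e_def)
          next
            case False
            then have "Suc i < 2 * m" using i by simp
            then have "d < int m" using d \<open>odd i\<close> by presburger
            moreover have eq: "w + p i - 2 * d = w + p (Suc i)" using d \<open>odd i\<close> by (simp add: p_def; presburger)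
            ultimately show ?thesis using \<open>Suc i < 2 * m\<close> unfolding \<sigma>e by (simp add: e_def eq del: diff_add_eq)
          qed
        next
          case False
          then have "Suc i < 2 * m" using i by presburger
          then have "d > int m" using d False k by simp
          moreover have "p i + 1 - 2 * d = p (Suc i) + (- 2) * k" using d False by (simp add: p_def; presburger)
          then have "w + p i + (1 - 2 * d) = w + p (Suc i) + (- 2) * k" by simp
          then have "(w + p i + 1 - 2 * d) mod k = (w + p (Suc i)) mod k" by (metis mod_mult_self1 add_diff_eq)
          ultimately show ?thesis using \<open>Suc i < 2 * m\<close> unfolding \<sigma>e by (simp add: e_def add_diff_eq)
        qed
      qed
      have inj: "inj_on e {..<2 * m}"
      proof (rule inj_onI)
        fix i j assume ij: "i \<in> {..<2 * m}" "j \<in> {..<2 * m}" "e i = e j"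
        show "i = j"
        proof (cases "i = 0 \<or> j = 0")
          case True
          then show ?thesis using ij by (auto simp: e_def split: if_splits)
        next
          case False
          then have eq: "(w + p i) mod k = (w + p j) mod k" using ij by (auto simp: e_def split: if_splits)
          have "- int m < p i" "p i \<le> int m" "- int m < p j" "p j \<le> int m"
            using ij by (auto simp: p_def)
          then have "p i = p j" using mod_eq_small[OF eq] k by auto
          moreover have "p (2 * a) = - int a" "p (Suc (2 * a)) = int a + 1" for a by (simp_all add: p_def)
          ultimately show ?thesis using False by (cases "even i"; cases "even j") (auto elim!: evenE oddE)
        qed
      qed
      have "\<exists>i<2 * m. x = e i"
      proof (cases x)
        case None
        then show ?thesis using assms by (intro exI[of _ 0]) (simp add: e_def)
      next
        case (Some y)
        then have y: "y \<in> {0..<k}" "y \<noteq> w" using x \<open>v = Some w\<close> by auto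
        define d where "d = (y - w) mod k"
        have "0 \<le> d" "d < k" using k by (auto simp: d_def)
        moreover have "d \<noteq> 0"
        proof
          assume "d = 0"
          then have "(y - w) mod k = 0 mod k" by (simp add: d_def)
          moreover have "\<bar>y - w - 0\<bar> < k" using y w by auto
          ultimately have "y - w = 0" by (rule mod_eq_small)
          then show False using y by simp
        qed
        ultimately have d: "0 < d" "d < k" by auto
        have yd: "(w + d) mod k = y" using y by (simp add: d_def mod_simps)
        \<comment> \<open>The inverse of \<open>p\<close>: offsets from 1 to \<open>m\<close> stand
          at odd positions, the negative offsets \<open>d - k\<close> at even ones.\<close>
        define i where "i = nat (if d \<le> int m then 2 * d - 1 else 2 * (k - d))"
        have "i < 2 * m" "i \<noteq> 0" using d k by (auto simp: i_def)
        moreover have "p i = d \<or> p i = d - k"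
          using d k by (auto simp: i_def p_def even_nat_iff)
        then have "(w + p i) mod k = y"
        proof
          assume "p i = d - k"
          then have "w + p i + k = w + d" by simp
          then show ?thesis using yd by (metis mod_add_self2)
        qed (use yd in simp)
        ultimately show ?thesis using Some by (auto simp: e_def)
      qed
      then show ?thesis using k_orbit_enumI[OF step inj] by blast
    qed
  qed
  then show ?thesis unfolding k_def by blast
qed

text \<open>The base factor \<open>\<phi>\<close> misses 0, and the others are its translates modulo
  \<open>2 * K + 1\<close>. By \<open>ortho\<close> its displacements are pairwise different, so no
  two translates share an arc.\<close>

lemma near_factors_cyclic:
  fixes \<phi> :: "int \<Rightarrow> int" and K :: int
  assumes "K \<ge> 0" and closed: "\<And>x. x \<in> {- K..K} \<Longrightarrow> \<phi> x \<in> {- K..K}" and "\<phi> 0 = 0"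
    and ortho: "\<And>x y. x \<in> {- K..K} \<Longrightarrow> y \<in> {- K..K} \<Longrightarrow>
      (\<phi> x - x) mod (2 * K + 1) = (\<phi> y - y) mod (2 * K + 1) \<Longrightarrow> x = y"
    and orb: "\<And>x. x \<in> {- K..K} \<Longrightarrow> x \<noteq> 0 \<Longrightarrow> k_orbit k \<phi> x"
  shows "\<exists>\<sigma>. near_factors k {- K..K} \<sigma>"
proof -
  define n where "n = 2 * K + 1"
  define wrap where "wrap y = (y + K) mod n - K" for y
  have "n > 0" using \<open>K \<ge> 0\<close> by (simp add: n_def)
  have wrap_in: "wrap y \<in> {- K..K}" for y
    using \<open>n > 0\<close> pos_mod_bound[of n "y + K"] by (auto simp: wrap_def n_def)
  have wrap_id: "wrap y = y" if "y \<in> {- K..K}" for y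
    using that by (simp add: wrap_def n_def)
  have wrap_mod: "wrap y mod n = y mod n" for y
    by (simp add: wrap_def mod_simps)
  have wrap_eq: "wrap x = wrap y \<longleftrightarrow> x mod n = y mod n" for x y
    using wrap_mod by (metis wrap_def mod_add_left_eq)
  define \<sigma> where "\<sigma> v x = wrap (v + \<phi> (wrap (x - v)))" for v x
  let ?V = "{- K..K}"
  have eq_iff: "x = y" if "x mod n = y mod n" "x \<in> ?V" "y \<in> ?V" for x y
    using that wrap_eq wrap_id by metis
  have "near_factors k ?V \<sigma>"
    unfolding near_factors_def
  proof (intro conjI ballI)
    fix v x assume "v \<in> ?V" "x \<in> ?V"
    show "\<sigma> v x \<in> ?V" unfolding \<sigma>_def by (rule wrap_in)
  next
    fix v assume "v \<in> ?V"
    then show "\<sigma> v v = v" using \<open>\<phi> 0 = 0\<close> \<open>K \<ge> 0\<close> by (simp add: \<sigma>_def wrap_id)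
  next
    fix x assume x: "x \<in> ?V"
    show "inj_on (\<lambda>v. \<sigma> v x) ?V"
    proof (rule inj_onI)
      fix v w assume v: "v \<in> ?V" and w: "w \<in> ?V" and eq: "\<sigma> v x = \<sigma> w x"
      let ?d = "wrap (x - v)" and ?e = "wrap (x - w)"
      \<comment> \<open>Modulo \<open>n\<close> the displacement of the base arc is the target minus
        \<open>x\<close>, so a common target forces a common displacement.\<close>
      have shift: "(\<phi> (wrap (x - v)) - wrap (x - v)) mod n = (v + \<phi> (wrap (x - v)) - x) mod n" for v
      proof -
        have "(\<phi> (wrap (x - v)) - wrap (x - v)) mod n = (\<phi> (wrap (x - v)) - (x - v)) mod n"
          using wrap_mod mod_diff_right_eq by metis
        then show ?thesis by (simp add: algebra_simps)
      qed
      have "(v + \<phi> ?d) mod n = (w + \<phi> ?e) mod n" using eq unfolding \<sigma>_def wrap_eq .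
      then have "(v + \<phi> ?d - x) mod n = (w + \<phi> ?e - x) mod n" by (metis mod_diff_left_eq)
      then have "?d = ?e" using ortho[OF wrap_in wrap_in] shift unfolding n_def by metis
      then have "(x - (x - v)) mod n = (x - (x - w)) mod n" unfolding wrap_eq by (metis mod_diff_right_eq)
      then show "v = w" using eq_iff v w by simp
    qed
  next
    fix v x assume v: "v \<in> ?V" and x: "x \<in> ?V - {v}"
    define h where "h y = wrap (v + y)" for y
    have h_wrap: "h (wrap (x - v)) = x"
    proof -
      have "(v + wrap (x - v)) mod n = (v + (x - v)) mod n" using wrap_mod mod_add_right_eq by metis
      then show ?thesis using wrap_id x unfolding h_def by (metis DiffD1 add_diff_cancel_left' diff_add_cancel add.commute wrap_eq)
    qed
    have "wrap (x - v) \<noteq> 0" using h_wrap v x wrap_id[OF v] by (auto simp: h_def)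
    then have o: "k_orbit k \<phi> (wrap (x - v))" using orb[OF wrap_in] by blast
    have wrap_h: "wrap (h y - v) = y" if "y \<in> ?V" for y
    proof -
      have "(h y - v) mod n = (v + y - v) mod n" unfolding h_def using wrap_mod mod_diff_left_eq by metis
      then show ?thesis using wrap_id[OF that] wrap_eq by (metis add_diff_cancel_left')
    qed
    have "k_orbit k (\<sigma> v) (h (wrap (x - v)))"
    proof (rule k_orbit_transfer[OF o wrap_in])
      show "inj_on h ?V" using wrap_h by (metis inj_onI)
      show "\<sigma> v (h y) = h (\<phi> y)" if "y \<in> ?V" for y
        using wrap_h[OF that] by (simp add: \<sigma>_def h_def)
    qed (rule closed)
    then show "k_orbit k (\<sigma> v) x" unfolding h_wrap .
  qed
  then show ?thesis by blast
qed

text \<open>The cycle \<open>1, -2, 3, -4, \<dots>, -2 m\<close> in \<open>\<int>\<^bsub>4 m + 1\<^esub>\<close> has the differences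
  \<open>\<plusminus>3, \<plusminus>5, \<dots>, \<plusminus>(4 m - 1)\<close> and, from its closing edge, a repeated one instead of \<open>\<plusminus>1\<close>.
  Changing all signs from the entry \<open>m\<close> on repairs this: the difference \<open>\<plusminus>(2 m - 1)\<close> of the entries
  \<open>m - 1\<close> and \<open>m\<close> becomes \<open>\<plusminus>1\<close>, and the closing difference becomes \<open>\<plusminus>(2 m - 1)\<close>.\<close>

lemma near_factors_two:
  assumes "m \<ge> 2"
  shows "\<exists>\<sigma>. near_factors (2 * m) {- 2 * int m..2 * int m} \<sigma>"
proof -
  define M where "M = int m"
  have M: "M \<ge> 2" using assms by (simp add: M_def)
  \<comment> \<open>A step raises the absolute value by 1 and flips the sign, but keeps the sign
    from \<open>M - 1\<close> to \<open>M\<close> and from \<open>2 * M\<close> back to 1. The cycle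
    and its negative cover all nonzero points.\<close>
  define \<phi> where "\<phi> x = (if x = 0 then 0 else if \<bar>x\<bar> = 2 * M then sgn x
      else if \<bar>x\<bar> = M - 1 then x + sgn x else - (x + sgn x))" for x
  have "\<exists>\<sigma>. near_factors (2 * m) {- (2 * M)..2 * M} \<sigma>"
  proof (rule near_factors_cyclic)
    show "\<phi> x \<in> {- (2 * M)..2 * M}" if "x \<in> {- (2 * M)..2 * M}" for x
      using that M by (auto simp: \<phi>_def sgn_if)
    show "x = y" if x: "x \<in> {- (2 * M)..2 * M}" and y: "y \<in> {- (2 * M)..2 * M}"
      and eq: "(\<phi> x - x) mod (2 * (2 * M) + 1) = (\<phi> y - y) mod (2 * (2 * M) + 1)" for x y
    proof -
      define r where "r x = \<phi> x - x" for x
      have cases: "x = 0 \<and> r x = 0 \<or> x = 2 * M \<and> r x = 1 - 2 * M \<or> x = - 2 * M \<and> r x = 2 * M - 1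
        \<or> x = M - 1 \<and> r x = 1 \<or> x = 1 - M \<and> r x = - 1
        \<or> 0 < x \<and> x < 2 * M \<and> x \<noteq> M - 1 \<and> r x = - 2 * x - 1
        \<or> x < 0 \<and> - 2 * M < x \<and> x \<noteq> 1 - M \<and> r x = - 2 * x + 1" if "x \<in> {- (2 * M)..2 * M}" for x
        using that M by (auto simp: r_def \<phi>_def sgn_if)
      have bound: "\<bar>r x\<bar> < 4 * M + 1" if "x \<in> {- (2 * M)..2 * M}" for x
        using cases[OF that] M by linarith
      have "\<bar>r x - r y\<bar> < 2 * (2 * (2 * M) + 1)"
        using bound[OF x] bound[OF y] unfolding abs_less_iff by (simp only: mult_2 minus_diff_eq) linarith
      note diff = mod_eq_cases[OF eq[folded r_def] this]
      \<comment> \<open>Two odd displacements differ by an even number, which cannot be plus or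
        minus the odd modulus; congruent ones are therefore equal.\<close>
      have parity: "r x = 0 \<or> odd (r x)" if "x \<in> {- (2 * M)..2 * M}" for x
        using cases[OF that] by (elim disjE conjE) simp_all
      have "r x = r y"
      proof (cases "r x = 0 \<or> r y = 0")
        case True
        then show ?thesis using diff bound[OF x] bound[OF y] unfolding abs_less_iff by auto
      next
        case False
        then have "even (r x - r y)" using parity[OF x] parity[OF y] by simp
        moreover have "odd (2 * (2 * M) + 1)" "odd (- (2 * (2 * M) + 1))" by simp_all
        ultimately show ?thesis using diff by (metis eq_iff_diff_eq_0)
      qed
      then show ?thesis using cases[OF x] cases[OF y] M by (elim disjE conjE) linarith+
    qed
    show "k_orbit (2 * m) \<phi> x" if x: "x \<in> {- (2 * M)..2 * M}" "x \<noteq> 0" for x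
    proof -
      \<comment> \<open>Up to the overall sign \<open>s\<close>, this is the sign of the entry of
        absolute value \<open>j\<close>: alternating, except between \<open>m - 1\<close> and
        \<open>m\<close>. The choice of \<open>s\<close> below selects, of the two opposite cycles,
        the one through \<open>x\<close>.\<close>
      define \<epsilon> :: "nat \<Rightarrow> int" where "\<epsilon> j = (if even j \<longleftrightarrow> j < m then 1 else - 1)" for j
      define i where "i = nat (\<bar>x\<bar> - 1)"
      have i: "i < 2 * m" "int (Suc i) = \<bar>x\<bar>" using x by (auto simp: i_def M_def)
      define s where "s = sgn x * \<epsilon> (Suc i)"
      define e where "e j = s * \<epsilon> (Suc j) * int (Suc j)" for j
      have s: "s = 1 \<or> s = - 1" using x by (auto simp: s_def \<epsilon>_def sgn_if)
      have \<epsilon>: "\<epsilon> j = 1 \<or> \<epsilon> j = - 1" for j by (auto simp: \<epsilon>_def)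
      have abs_e: "\<bar>e j\<bar> = int (Suc j)" and sgn_e: "sgn (e j) = s * \<epsilon> (Suc j)" for j
        using s \<epsilon>[of "Suc j"] by (auto simp: e_def sgn_if)
      have "k_orbit (2 * m) \<phi> (e i)"
      proof (rule k_orbit_enumI[OF _ _ i(1)])
        show "inj_on e {..<2 * m}" using abs_e by (metis inj_onI of_nat_eq_iff nat.inject)
        fix j assume j: "j < 2 * m"
        have "e j \<noteq> 0" using abs_e[of j] by auto
        consider "Suc j = 2 * m" | "Suc j = m - 1" | "Suc j < 2 * m" "Suc j \<noteq> m - 1" using j by linarith
        then show "\<phi> (e j) = e (Suc j mod (2 * m))"
        proof cases
          case 1
          then have "\<phi> (e j) = sgn (e j)" using abs_e[of j] \<open>e j \<noteq> 0\<close> by (simp add: \<phi>_def M_def)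
          moreover have "\<epsilon> (2 * m) = - 1" "\<epsilon> 1 = - 1" using assms by (auto simp: \<epsilon>_def)
          ultimately show ?thesis using 1 by (simp add: sgn_e) (simp add: e_def)
        next
          case 2
          then have "\<phi> (e j) = e j + sgn (e j)" using abs_e[of j] \<open>e j \<noteq> 0\<close> assms by (simp add: \<phi>_def M_def of_nat_diff)
          moreover have "\<epsilon> (Suc (Suc j)) = \<epsilon> (Suc j)" using 2 assms by (auto simp: \<epsilon>_def)
          moreover have "Suc j < 2 * m" using 2 assms by simp
          ultimately show ?thesis by (simp add: sgn_e) (simp add: e_def algebra_simps)
        next
          case 3
          then have "\<phi> (e j) = - (e j + sgn (e j))" using abs_e[of j] \<open>e j \<noteq> 0\<close> assms by (auto simp: \<phi>_def M_def)
          moreover have "\<epsilon> (Suc (Suc j)) = - \<epsilon> (Suc j)" using 3 by (auto simp: \<epsilon>_def)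
          ultimately show ?thesis using 3 by (simp add: sgn_e) (simp add: e_def algebra_simps)
        qed
      qed
      moreover have "e i = x"
      proof -
        have "e i = sgn x * (\<epsilon> (Suc i) * \<epsilon> (Suc i)) * int (Suc i)" by (simp add: e_def s_def)
        also have "\<dots> = sgn x * \<bar>x\<bar>" using \<epsilon>[of "Suc i"] i(2) by auto
        finally show ?thesis by (simp add: sgn_mult_abs)
      qed
      ultimately show ?thesis by simp
    qed
  qed (use M in \<open>auto simp: \<phi>_def\<close>)
  then show ?thesis by (simp add: M_def)
qed

section \<open>All orders\<close>

text \<open>One group is \<open>?W\<close>, two halves of \<open>m * t\<close> points each. The
  frame on \<open>card I\<close> groups is filled with copies of the given solution.\<close>

lemma near_factors_product:
  assumes "holey_matching I \<pi>" and "finite I"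
    and nf: "near_factors (2 * m) {..<2 * m * t + 1} \<sigma>" and "m \<ge> 1" and "t \<ge> 1"
  shows "\<exists>\<rho> :: nat \<Rightarrow> nat \<Rightarrow> nat. near_factors (2 * m) {..<2 * m * (card I * t) + 1} \<rho>"
proof -
  let ?W = "(UNIV :: bool set) \<times> {..<m} \<times> {..<t}"
  have card_option: "card (insert None (Some ` X)) = card X + 1" if "finite X" for X :: "'x set"
    using that by (simp add: card_image)
  have "card ?W = 2 * m * t" by (simp add: card_cartesian_product)
  then obtain \<sigma>' where \<sigma>': "near_factors (2 * m) (insert None (Some ` ?W)) \<sigma>'"
    using near_factors_transfer[OF nf, of "insert None (Some ` ?W)"] card_option[of ?W] by auto
  obtain \<tau> where "frame_factors (2 * m) I ?W \<tau>"
    using frame_factors_holey_matching[OF assms(1)] assms(4,5) by blast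
  then obtain \<rho> where \<rho>: "near_factors (2 * m) (insert None (Some ` (I \<times> ?W))) \<rho>"
    using near_factors_fill_frame[OF _ \<sigma>'] \<open>m \<ge> 1\<close> by fastforce
  have "card (I \<times> ?W) = 2 * m * (card I * t)" by (simp add: card_cartesian_product)
  then have "card (insert None (Some ` (I \<times> ?W))) = card {..<2 * m * (card I * t) + 1}"
    using card_option[of "I \<times> ?W"] \<open>finite I\<close> by simp
  then show ?thesis
    using near_factors_transfer[OF \<rho>, of "{..<2 * m * (card I * t) + 1}"] \<open>finite I\<close> by auto
qed

lemma near_factors_exists:
  assumes "m \<ge> 2" and "t \<ge> 1"
  shows "\<exists>\<sigma> :: nat \<Rightarrow> nat \<Rightarrow> nat. near_factors (2 * m) {..<2 * m * t + 1} \<sigma>"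
  using \<open>t \<ge> 1\<close>
proof (induction t rule: less_induct)
  case (less t)
  have product: ?case if hm: "holey_matching {..<s} \<pi>" "t = s * t'" "t' < t" "t' \<ge> 1" for s t' \<pi>
  proof -
    obtain \<sigma> :: "nat \<Rightarrow> nat \<Rightarrow> nat" where "near_factors (2 * m) {..<2 * m * t' + 1} \<sigma>"
      using less.IH[OF hm(3,4)] by blast
    then show ?thesis
      using near_factors_product[OF hm(1), of m t' \<sigma>] hm \<open>m \<ge> 2\<close> by simp
  qed
  \<comment> \<open>Multiples of 4 use 4 groups; odd \<open>t\<close> uses \<open>t\<close> groups
    with \<open>t' = 1\<close>; twice an odd number uses \<open>t div 2\<close> groups with
    \<open>t' = 2\<close>.\<close>
  consider "t = 1" | "t = 2" | "4 dvd t" | "odd t" "t \<noteq> 1" | "even t" "odd (t div 2)" "t \<noteq> 2"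
  proof -
    have "4 dvd t" if "even t" "even (t div 2)" using that by presburger
    then show thesis using that by blast
  qed
  then show ?case
  proof cases
    case 1
    obtain \<sigma> where \<sigma>: "near_factors (2 * m) (insert None (Some ` {0..<2 * int m})) \<sigma>"
      using near_factors_one[OF \<open>m \<ge> 2\<close>] by blast
    have "card (insert None (Some ` {0..<2 * int m})) = 2 * m + 1" by (simp add: card_image)
    then show ?thesis
      using near_factors_transfer[OF \<sigma>, of "{..<2 * m * t + 1}"] 1 by simp
  next
    case 2
    obtain \<sigma> where \<sigma>: "near_factors (2 * m) {- 2 * int m..2 * int m} \<sigma>"
      using near_factors_two[OF \<open>m \<ge> 2\<close>] by blast
    have "card {- 2 * int m..2 * int m} = 2 * m * 2 + 1" by simp
    then show ?thesis
      using near_factors_transfer[OF \<sigma>, of "{..<2 * m * t + 1}"] 2 by simp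
  next
    case 3
    then obtain t' where "t = 4 * t'" by blast
    then show ?thesis using product[of 4 _ t'] holey_matching_4 less.prems by auto
  next
    case 4
    then show ?thesis using product[of t _ 1] holey_matching_odd[of t] less.prems by auto
  next
    case 5
    have t: "t = (t div 2) * 2" using 5 by simp
    then have "2 < t" using 5 less.prems by presburger
    then show ?thesis using product[OF _ t] holey_matching_odd[OF 5(2)] by auto
  qed
qed

section \<open>From near-factors to partial cycle factors\<close>

lemma k_orbit_iterate:
  assumes "k_orbit k f x" and "i < k" and "j < k" and "(f ^^ i) x = (f ^^ j) x"
  shows "i = j"
proof -
  have False if "(f ^^ i) x = (f ^^ j) x" "i < j" "j < k" for i j
  proof -
    have "(f ^^ (k - j)) ((f ^^ i) x) = (f ^^ (k - j)) ((f ^^ j) x)" using that by simp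
    also have "\<dots> = x" using assms(1) that unfolding k_orbit_def
      by (metis comp_apply funpow_add le_add_diff_inverse2 less_imp_le)
    finally have "(f ^^ (k - j + i)) x = x" by (simp add: funpow_add)
    moreover have "0 < k - j + i" "k - j + i < k" using that by auto
    ultimately show False using assms(1) unfolding k_orbit_def by blast
  qed
  then show ?thesis using assms by (metis linorder_neqE_nat)
qed

text \<open>An orbit is closed under \<open>f\<close> and, as \<open>f\<close> is injective on
  \<open>X\<close>, under preimages, so adjacency never leaves it. Its edges are indexed by their
  start vertices.\<close>

lemma orbit_components_are_cycles:
  assumes "finite X" and closed: "\<And>x. x \<in> X \<Longrightarrow> f x \<in> X"
    and orb: "\<And>x. x \<in> X \<Longrightarrow> k_orbit k f x" and "k > 0"
    and "C \<in> mg_components \<lparr>mverts = X, medges = image_mset (\<lambda>z. {z, f z}) (mset_set X)\<rparr>"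
  shows "is_cycle_of_length k C"
proof -
  define P where "P = \<lparr>mverts = X, medges = image_mset (\<lambda>z. {z, f z}) (mset_set X)\<rparr>"
  obtain v where v: "v \<in> X" and C: "C = induced_mgraph P {w. (mg_adj P)\<^sup>*\<^sup>* v w}"
    using assms(5) unfolding mg_components_def P_def by auto
  define it where "it i = (f ^^ i) v" for i
  define O' where "O' = it ` {..<k}"
  have itX: "it i \<in> X" for i unfolding it_def by (induction i) (auto simp: v closed)
  have itk: "it k = v" using orb[OF v] by (simp add: it_def k_orbit_def)
  have f_it: "f (it i) = it (Suc i)" for i by (simp add: it_def)
  have it_mod: "it (Suc i) = it (Suc i mod k)" if "i < k" for i
    using that itk by (cases "Suc i = k") (auto simp: it_def)
  have f_closed: "f y \<in> O'" if "y \<in> O'" for y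
    using that it_mod \<open>k > 0\<close> by (auto simp: O'_def f_it)
  have f_back: "z \<in> O'" if z: "z \<in> X" "f z \<in> O'" for z
  proof -
    obtain i where i: "i < k" "f z = it i" using z by (auto simp: O'_def)
    define j where "j = (if i = 0 then k - 1 else i - 1)"
    have j: "j < k" "Suc j mod k = i" using i \<open>k > 0\<close> by (auto simp: j_def)
    have "f z = f (it j)" using i(2) it_mod[OF j(1)] j(2) by (simp add: f_it)
    then have "z = it j" using k_orbit_eqD[OF orb orb] z(1) itX \<open>k > 0\<close> by blast
    then show ?thesis using j by (simp add: O'_def)
  qed
  have adj: "mg_adj P x y \<longleftrightarrow> (\<exists>z\<in>X. {x, y} = {z, f z})" for x y
    using \<open>finite X\<close> by (auto simp: mg_adj_def P_def)
  have reach: "{w. (mg_adj P)\<^sup>*\<^sup>* v w} = O'"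
  proof
    show "{w. (mg_adj P)\<^sup>*\<^sup>* v w} \<subseteq> O'"
    proof safe
      fix w assume "(mg_adj P)\<^sup>*\<^sup>* v w"
      then show "w \<in> O'"
      proof (induction rule: rtranclp_induct)
        case base
        show ?case unfolding O'_def by (rule image_eqI[of _ _ 0]) (use \<open>k > 0\<close> in \<open>auto simp: it_def\<close>)
      next
        case (step x y)
        then obtain z where "z \<in> X" "{x, y} = {z, f z}" using adj by blast
        then show ?case using f_closed f_back step.IH by (auto simp: doubleton_eq_iff)
      qed
    qed
    have "(mg_adj P)\<^sup>*\<^sup>* v (it i)" for i
    proof (induction i)
      case (Suc i)
      have "mg_adj P (it i) (it (Suc i))" unfolding adj using itX f_it by metis
      then show ?case using Suc by (rule rtranclp.rtrancl_into_rtrancl[rotated])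
    qed (simp add: it_def)
    then show "O' \<subseteq> {w. (mg_adj P)\<^sup>*\<^sup>* v w}" by (auto simp: O'_def)
  qed
  have inj: "inj_on it {..<k}"
    using k_orbit_iterate[OF orb[OF v]] by (auto simp: inj_on_def it_def)
  have "O' \<subseteq> X" using itX by (auto simp: O'_def)
  have "{z \<in> X. {z, f z} \<subseteq> O'} = O'" using \<open>O' \<subseteq> X\<close> f_closed by auto
  then have "filter_mset (\<lambda>e. e \<subseteq> O') (medges P) = image_mset (\<lambda>z. {z, f z}) (mset_set O')"
    using \<open>finite X\<close> by (simp add: P_def filter_mset_image_mset filter_mset_mset_set)
  also have "\<dots> = image_mset (\<lambda>i. {it i, f (it i)}) (mset_set {..<k})"
    unfolding O'_def by (simp add: image_mset_mset_set[OF inj, symmetric] image_mset.compositionality comp_def)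
  also have "\<dots> = image_mset (\<lambda>i. {it i, it (Suc i mod k)}) (mset_set {..<k})"
    by (intro image_mset_cong) (auto simp: f_it it_mod)
  also have "\<dots> = image_mset (\<lambda>i. {map it [0..<k] ! i, map it [0..<k] ! (Suc i mod k)}) (mset_set {..<k})"
    by (intro image_mset_cong) (use \<open>k > 0\<close> in auto)
  finally have "medges C = image_mset (\<lambda>i. {map it [0..<k] ! i, map it [0..<k] ! (Suc i mod k)}) (mset_set {..<k})"
    by (simp add: C induced_mgraph_def reach)
  moreover have "mverts C = set (map it [0..<k])"
  proof -
    have "mverts C = X \<inter> O'" unfolding C induced_mgraph_def reach by (simp add: P_def)
    then show ?thesis using \<open>O' \<subseteq> X\<close> by (auto simp: O'_def)
  qed
  moreover have "distinct (map it [0..<k])"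
    using inj by (simp add: distinct_map atLeast0LessThan)
  ultimately show ?thesis unfolding is_cycle_of_length_def by (intro exI[of _ "map it [0..<k]"]) simp
qed

section \<open>Lifting to the tensor product and counting edges\<close>

lemma sum_mset_image_mset_Sigma:
  assumes "finite A" and "\<And>a. a \<in> A \<Longrightarrow> finite (X a)"
  shows "\<Sum>\<^sub># (image_mset (\<lambda>a. image_mset (\<phi> a) (mset_set (X a))) (mset_set A))
    = image_mset (\<lambda>(a, x). \<phi> a x) (mset_set (Sigma A X))"
  using assms
proof (induction A rule: finite_induct)
  case (insert a A)
  have "Sigma (insert a A) X = Pair a ` X a \<union> Sigma A X" by auto
  moreover have "mset_set (Pair a ` X a \<union> Sigma A X) = mset_set (Pair a ` X a) + mset_set (Sigma A X)"
    by (rule mset_set_Union) (use insert in auto)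
  moreover have "mset_set (Pair a ` X a) = image_mset (Pair a) (mset_set (X a))"
    by (simp add: image_mset_mset_set inj_on_def)
  ultimately show ?case
    using insert by (simp add: image_mset.compositionality comp_def)
qed simp

text \<open>Every edge arises from exactly its two orientations, which is the source of the
  multiplicity 2.\<close>

lemma image_mset_arcs:
  assumes "finite D" and sym: "\<And>a b. (a, b) \<in> D \<Longrightarrow> (b, a) \<in> D" and irrefl: "\<And>a. (a, a) \<notin> D"
  shows "image_mset (\<lambda>(a, b). {a, b}) (mset_set D) = repeat_mset 2 (mset_set {{a, b} | a b. (a, b) \<in> D})"
proof (rule multiset_eqI)
  fix e
  let ?E = "{{a, b} | a b. (a, b) \<in> D}"
  have "?E = (\<lambda>(a, b). {a, b}) ` D" by force
  then have "finite ?E" using \<open>finite D\<close> by simp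
  have c: "count (image_mset (\<lambda>(a, b). {a, b}) (mset_set D)) e = card {p \<in> D. (case p of (a, b) \<Rightarrow> {a, b}) = e}"
  proof -
    have "count (image_mset (\<lambda>(a, b). {a, b}) (mset_set D)) e
        = (\<Sum>p | p \<in># mset_set D \<and> e = (case p of (a, b) \<Rightarrow> {a, b}). count (mset_set D) p)"
      by (rule count_image_mset')
    also have "\<dots> = (\<Sum>p\<in>{p \<in> D. (case p of (a, b) \<Rightarrow> {a, b}) = e}. 1)"
      using \<open>finite D\<close> by (intro sum.cong) auto
    finally show ?thesis by simp
  qed
  show "count (image_mset (\<lambda>(a, b). {a, b}) (mset_set D)) e = count (repeat_mset 2 (mset_set ?E)) e"
  proof (cases "e \<in> ?E")
    case True
    then obtain a b where ab: "e = {a, b}" "(a, b) \<in> D" by blast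
    then have "{p \<in> D. (case p of (a, b) \<Rightarrow> {a, b}) = e} = {(a, b), (b, a)}"
      using sym by (auto simp: doubleton_eq_iff)
    moreover have "a \<noteq> b" using ab irrefl by blast
    ultimately show ?thesis using c True \<open>finite ?E\<close> by simp
  next
    case False
    then have empty: "{p \<in> D. (case p of (a, b) \<Rightarrow> {a, b}) = e} = {}" by auto
    show ?thesis using c[unfolded empty] False \<open>finite ?E\<close> by simp
  qed
qed

lemma ARCS_of_near_factors:
  assumes nf: "near_factors k {1..u} \<sigma>" and "even k" and "k > 0"
  shows "\<exists>F. is_ARCS k u g 2 F"
proof -
  let ?V = "{1..u}"
  have "k \<ge> 2" using assms(2,3) by presburger
  have \<sigma>_in: "\<sigma> v x \<in> ?V" if "v \<in> ?V" "x \<in> ?V" for v x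
    using nf that unfolding near_factors_def by blast
  have \<sigma>_orbit: "k_orbit k (\<sigma> v) x" if "v \<in> ?V" "x \<in> ?V" "x \<noteq> v" for v x
    using nf that unfolding near_factors_def by blast
  have \<sigma>_neq: "\<sigma> v x \<noteq> v" if "v \<in> ?V" "x \<in> ?V" "x \<noteq> v" for v x
    using near_factors_neq[OF nf that \<open>k > 0\<close>] .
  have \<sigma>_moves: "\<sigma> v x \<noteq> x" if "v \<in> ?V" "x \<in> ?V" "x \<noteq> v" for v x
  proof -
    have "(\<sigma> v ^^ 1) x \<noteq> x" using \<sigma>_orbit[OF that] \<open>k \<ge> 2\<close> unfolding k_orbit_def by fastforce
    then show ?thesis by simp
  qed
  have \<sigma>_inj: "inj_on (\<lambda>v. \<sigma> v x) ?V" and \<sigma>_id: "\<sigma> x x = x" if "x \<in> ?V" for x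
    using nf that unfolding near_factors_def by blast+
  have "\<forall>v\<in>?V. \<exists>c. \<forall>x\<in>?V - {v}. c (\<sigma> v x) \<longleftrightarrow> \<not> c x"
    using \<sigma>_orbit by (intro ballI k_orbit_even_colouring[OF assms(2,3)]) auto
  then obtain c :: "nat \<Rightarrow> nat \<Rightarrow> bool" where c: "\<And>v x. v \<in> ?V \<Longrightarrow> x \<in> ?V - {v} \<Longrightarrow> c v (\<sigma> v x) \<longleftrightarrow> \<not> c v x"
    by metis
  \<comment> \<open>Rotation by \<open>s\<close> of the vertices 1 to \<open>g\<close>; the rotation
    by \<open>-s\<close> is written with \<open>g - s\<close>.\<close>
  define rot where "rot s h = (h - 1 + s) mod g + 1" for s h
  have rot_in: "rot s h \<in> {1..g}" if "h \<in> {1..g}" for s h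
    using that by (auto simp: rot_def Suc_le_eq)
  have rot_back: "rot s' (rot s h) = h" if "s + s' = g" "h \<in> {1..g}" for s s' h
  proof -
    have "rot s' (rot s h) = (h - 1 + (s + s')) mod g + 1" by (simp add: rot_def mod_add_left_eq add.assoc)
    then show ?thesis using that by auto
  qed
  have rot_eqD: "s = s'" if "rot s h = rot s' h" "s < g" "s' < g" for s s' h
    using that mod_add_left_eqD[of "h - 1" s g s'] by (simp add: rot_def)
  have rot_ex: "\<exists>s\<in>{1..<g}. rot s h = h'" if "h \<in> {1..g}" "h' \<in> {1..g}" "h \<noteq> h'" for h h'
  proof -
    define s where "s = (h' + g - h) mod g"
    have "h - 1 + (h' + g - h) = h' - 1 + g" using that by auto
    then have "rot s h = (h' - 1 + g) mod g + 1" by (simp add: rot_def s_def mod_add_right_eq)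
    then have "rot s h = h'" using that by auto
    moreover have "s \<noteq> 0"
    proof
      assume "s = 0"
      then have "rot s h = h" using that by (auto simp: rot_def)
      then show False using \<open>rot s h = h'\<close> that by simp
    qed
    moreover have "s < g" using that by (auto simp: s_def)
    ultimately show ?thesis by force
  qed
  have rot_moves: "rot s h \<noteq> h" if "h \<in> {1..g}" "s \<in> {1..<g}" for s h
  proof
    assume "rot s h = h"
    moreover have "rot 0 h = h" using that by (auto simp: rot_def)
    ultimately have "rot s h = rot 0 h" by simp
    then show False using rot_eqD[of s h 0] that by auto
  qed
  define \<tau> where "\<tau> v s p = (case p of (x, h) \<Rightarrow> (\<sigma> v x, rot (if c v x then s else g - s) h))" for v s p
  define X where "X v = (?V - {v}) \<times> {1..g}" for v
  have \<tau>_in: "\<tau> v s p \<in> X v" if "v \<in> ?V" "p \<in> X v" for v s p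
    using that \<sigma>_in \<sigma>_neq rot_in by (auto simp: \<tau>_def X_def)
  have \<tau>_orbit: "k_orbit k (\<tau> v s) p" if v: "v \<in> ?V" and s: "s \<in> {1..<g}" and p: "p \<in> X v" for v s p
  proof -
    have fst_iter: "fst ((\<tau> v s ^^ i) p) = (\<sigma> v ^^ i) (fst p)" for i
      by (induction i) (auto simp: \<tau>_def split: prod.splits)
    have iter_in: "(\<tau> v s ^^ i) p \<in> X v" for i
      by (induction i) (auto simp: p \<tau>_in[OF v])
    \<comment> \<open>Consecutive points of a cycle have opposite colours, so their rotations
      cancel.\<close>
    have twice: "snd (\<tau> v s (\<tau> v s q)) = snd q" if qX: "q \<in> X v" for q
    proof -
      obtain x h where q: "q = (x, h)" "x \<in> ?V - {v}" "h \<in> {1..g}" using qX unfolding X_def by blast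
      then show ?thesis using c[OF v q(2)] rot_back[of s "g - s" h] rot_back[of "g - s" s h] s
        by (auto simp: \<tau>_def)
    qed
    have snd_iter: "snd ((\<tau> v s ^^ (2 * i)) p) = snd p" for i
    proof (induction i)
      case (Suc i)
      have "(\<tau> v s ^^ (2 * Suc i)) p = \<tau> v s (\<tau> v s ((\<tau> v s ^^ (2 * i)) p))" by simp
      then show ?case using twice[OF iter_in] Suc by metis
    qed simp
    \<comment> \<open>The first coordinate has exact period \<open>k\<close>, and the second is back
      after \<open>k\<close> steps because \<open>k\<close> is even.\<close>
    have "k_orbit k (\<sigma> v) (fst p)" using \<sigma>_orbit[OF v, of "fst p"] p by (simp add: X_def mem_Times_iff)
    moreover have "snd ((\<tau> v s ^^ k) p) = snd p" using snd_iter \<open>even k\<close> by (metis evenE)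
    ultimately show ?thesis unfolding k_orbit_def by (metis fst_iter prod_eqI)
  qed
  define P where "P = (\<lambda>(v, s). \<lparr>mverts = X v, medges = image_mset (\<lambda>z. {z, \<tau> v s z}) (mset_set (X v))\<rparr>)"
  define A where "A = ?V \<times> {1..<g}"
  define F where "F = image_mset P (mset_set A)"
  \<comment> \<open>\<open>D\<close> consists of all arcs of the tensor product;
    \<open>\<Phi>\<close> sends a factor and a start vertex to the arc leaving it.\<close>
  define D where "D = {((x, h), (y, h')) | x h y h'. x \<in> ?V \<and> y \<in> ?V \<and> h \<in> {1..g} \<and> h' \<in> {1..g} \<and> x \<noteq> y \<and> h \<noteq> h'}"
  define \<Phi> where "\<Phi> = (\<lambda>((v, s), z). (z, \<tau> v s z))"
  define T where "T = Sigma A (\<lambda>(v, s). X v)"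
  have bij: "bij_betw \<Phi> T D"
    unfolding bij_betw_def
  proof
    show "inj_on \<Phi> T"
    proof (rule inj_onI)
      fix p q assume p: "p \<in> T" and q: "q \<in> T" and eq: "\<Phi> p = \<Phi> q"
      obtain v s x h where p': "p = ((v, s), (x, h))" "v \<in> ?V" "s \<in> {1..<g}" "x \<in> ?V" "h \<in> {1..g}"
        using p by (auto simp: T_def A_def X_def)
      obtain v' s' x' h' where q': "q = ((v', s'), (x', h'))" "v' \<in> ?V" "s' \<in> {1..<g}"
        using q by (auto simp: T_def A_def X_def)
      have "x' = x" "h' = h" "\<sigma> v x = \<sigma> v' x"
        using eq by (auto simp: \<Phi>_def \<tau>_def p' q')
      then have "v = v'" using \<sigma>_inj[OF p'(4)] p' q' by (auto dest: inj_onD)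
      then have "rot (if c v x then s else g - s) h = rot (if c v x then s' else g - s') h"
        using eq \<open>x' = x\<close> \<open>h' = h\<close> by (simp add: \<Phi>_def \<tau>_def p' q')
      then have "(if c v x then s else g - s) = (if c v x then s' else g - s')"
        by (rule rot_eqD) (use p' q' in auto)
      then have "s = s'" using p' q' by (auto split: if_splits)
      then show "p = q" using p' q' \<open>v = v'\<close> \<open>x' = x\<close> \<open>h' = h\<close> by simp
    qed
    show "\<Phi> ` T = D"
    proof
      show "\<Phi> ` T \<subseteq> D"
      proof
        fix a assume "a \<in> \<Phi> ` T"
        then obtain v s x h where a: "a = ((x, h), \<tau> v s (x, h))" "v \<in> ?V" "s \<in> {1..<g}" "(x, h) \<in> X v"
          by (auto simp: T_def A_def \<Phi>_def)
        define r where "r = (if c v x then s else g - s)"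
        have "r \<in> {1..<g}" using a by (auto simp: r_def)
        moreover have "x \<in> ?V" "x \<noteq> v" "h \<in> {1..g}" using a by (auto simp: X_def)
        ultimately show "a \<in> D"
          using a \<sigma>_in[of v x] \<sigma>_moves[of v x] rot_in[of h r] rot_moves[of h r]
          by (auto simp: D_def \<tau>_def r_def[symmetric])
      qed
      show "D \<subseteq> \<Phi> ` T"
      proof
        fix a assume "a \<in> D"
        then obtain x h y h' where a: "a = ((x, h), (y, h'))" "x \<in> ?V" "y \<in> ?V" "h \<in> {1..g}" "h' \<in> {1..g}"
          "x \<noteq> y" "h \<noteq> h'" by (auto simp: D_def)
        \<comment> \<open>An injection of a finite set into itself is onto, so every arc
          occurs.\<close>
        have "(\<lambda>v. \<sigma> v x) ` ?V = ?V"
          using \<sigma>_inj[OF a(2)] \<sigma>_in a(2) by (intro endo_inj_surj) auto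
        then obtain v where v: "v \<in> ?V" "\<sigma> v x = y" using a(3) by (metis imageE)
        have "v \<noteq> x" using v a \<sigma>_id by auto
        obtain r where r: "r \<in> {1..<g}" "rot r h = h'" using rot_ex a by blast
        \<comment> \<open>Chosen so that the colour of \<open>x\<close> turns \<open>s\<close> into
          the rotation \<open>r\<close>.\<close>
        define s where "s = (if c v x then r else g - r)"
        have "s \<in> {1..<g}" "(if c v x then s else g - s) = r" using r by (auto simp: s_def)
        then have "\<Phi> ((v, s), (x, h)) = a" "((v, s), (x, h)) \<in> T"
          using v r a \<open>v \<noteq> x\<close> by (auto simp: \<Phi>_def \<tau>_def T_def A_def X_def)
        then show "a \<in> \<Phi> ` T" by (metis imageI)
      qed
    qed
  qed
  have fin: "finite A" "\<And>p. finite ((\<lambda>(v, s). X v) p)" "finite T"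
    by (auto simp: A_def X_def T_def)
  have "\<Sum>\<^sub># (image_mset medges F)
      = \<Sum>\<^sub># (image_mset (\<lambda>p. image_mset ((\<lambda>(v, s) z. {z, \<tau> v s z}) p) (mset_set ((\<lambda>(v, s). X v) p))) (mset_set A))"
    unfolding F_def P_def
    by (simp add: image_mset.compositionality comp_def split_def)
  also have "\<dots> = image_mset (\<lambda>(p, z). (\<lambda>(v, s) z. {z, \<tau> v s z}) p z) (mset_set T)"
    unfolding T_def by (rule sum_mset_image_mset_Sigma) (use fin in auto)
  also have "\<dots> = image_mset (\<lambda>(a, b). {a, b}) (image_mset \<Phi> (mset_set T))"
    by (simp add: image_mset.compositionality comp_def \<Phi>_def split_def)
  also have "image_mset \<Phi> (mset_set T) = mset_set D"
    using bij by (metis bij_betw_def image_mset_mset_set)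
  also have "image_mset (\<lambda>(a, b). {a, b}) (mset_set D) = repeat_mset 2 (mset_set {{a, b} | a b. (a, b) \<in> D})"
  proof (rule image_mset_arcs)
    show "finite D" using bij fin(3) by (metis bij_betw_finite)
  qed (auto simp: D_def)
  also have "{{a, b} | a b. (a, b) \<in> D} = sedges (tensor_product (complete_sgraph u) (complete_sgraph g))"
  proof -
    have "{a, b} \<in> sedges (complete_sgraph n) \<longleftrightarrow> a \<in> {1..n} \<and> b \<in> {1..n} \<and> a \<noteq> b" for a b n
      by (auto simp: complete_sgraph_def card_insert_if)
    then show ?thesis unfolding tensor_product_def D_def by simp blast
  qed
  also have "repeat_mset 2 (mset_set \<dots>) = medges (KxK u g 2)"
    by (simp add: KxK_def edge_multiple_def)
  finally have total: "\<Sum>\<^sub># (image_mset medges F) = medges (KxK u g 2)" .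
  have "partial_cycle_factor k u g 2 Q" if QF: "Q \<in># F" for Q
  proof -
    obtain v s where v: "v \<in> ?V" and s: "s \<in> {1..<g}" and Q: "Q = P (v, s)"
      using QF fin(1) by (auto simp: F_def A_def)
    have "medges Q \<subseteq># medges (KxK u g 2)"
      using QF unfolding total[symmetric] by (metis image_mset_add_mset insert_DiffM mset_subset_eq_add_left sum_mset.insert)
    moreover have "\<forall>e\<in>#medges Q. e \<subseteq> X v"
      using \<tau>_in[OF v] fin(2)[of "(v, s)"] by (auto simp: Q P_def)
    moreover from this have "filter_mset (\<lambda>e. e \<subseteq> X v) (medges Q) = medges Q"
      by (simp add: filter_mset_eq_conv)
    moreover have "mverts (KxK u g 2) - partite_set g v = X v"
      by (auto simp: KxK_def edge_multiple_def tensor_product_def complete_sgraph_def partite_set_def X_def)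
    ultimately have "spanning_mg_subgraph Q (delete_verts (KxK u g 2) (partite_set g v))"
      unfolding spanning_mg_subgraph_def mg_subgraph_def delete_verts_def induced_mgraph_def
      using multiset_filter_mono[of "medges Q" "medges (KxK u g 2)" "\<lambda>e. e \<subseteq> X v"]
      by (auto simp: Q P_def)
    moreover have "is_cycle_of_length k C" if "C \<in> mg_components Q" for C
      by (rule orbit_components_are_cycles[of "X v" "\<tau> v s" k])
        (use that \<tau>_in[OF v] \<tau>_orbit[OF v s] fin(2)[of "(v, s)"] \<open>k > 0\<close> in \<open>auto simp: Q P_def\<close>)
    ultimately show ?thesis unfolding partial_cycle_factor_def using v by blast
  qed
  then show ?thesis unfolding is_ARCS_def using total by blast
qed

theorem theorem4p1:
  fixes k u g :: nat
  assumes "even k" and "k \<ge> 4"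
    and "u > 0" and "[u = 1] (mod k)"
    and "g \<ge> 2"
  shows "\<exists>F. is_ARCS k u g 2 F"
proof -
  obtain m where k: "k = 2 * m" and "m \<ge> 2" using \<open>even k\<close> \<open>k \<ge> 4\<close> by (auto elim: evenE)
  have "k dvd u - 1"
    using assms(4) by (rule cong_to_1_nat)
  then obtain t where t: "u = k * t + 1" using \<open>u > 0\<close> by (metis dvdE Suc_diff_1 Suc_eq_plus1)
  have "\<exists>\<sigma> :: nat \<Rightarrow> nat \<Rightarrow> nat. near_factors k {..<u} \<sigma>"
  proof (cases "t = 0")
    case True
    \<comment> \<open>With a single vertex there is no \<open>x\<close> other than \<open>v\<close>,
      so the identity qualifies.\<close>
    then have "near_factors k {..<u} (\<lambda>v x. x)" using t by (auto simp: near_factors_def inj_on_def)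
    then show ?thesis by blast
  next
    case False
    then show ?thesis using near_factors_exists[OF \<open>m \<ge> 2\<close>, of t] t k by simp
  qed
  then obtain \<sigma> :: "nat \<Rightarrow> nat \<Rightarrow> nat" where "near_factors k {..<u} \<sigma>" by blast
  then obtain \<rho> where "near_factors k {1..u} \<rho>"
    using near_factors_transfer[of k "{..<u}" \<sigma> "{1..u}"] by auto
  then show ?thesis using ARCS_of_near_factors \<open>even k\<close> \<open>k \<ge> 4\<close> by simp
qed

end
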